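(* Let $g_1,\dots,g_m\in\mathbb{R}[x]=\mathbb{R}[x_1,\dots,x_n]$, let $V:=\{x\in\mathbb{R}^n : g_j(x)=0,\ j=1,\dots,m\}$, and let $f\in\mathbb{R}[x]$ be nonnegative on $V$. Then, for every $\epsilon>0$, there exist $r(\epsilon)\in\mathbb{N}$ and nonnegative scalars $\lambda_1,\dots,\lambda_m$ such that, for all $r\ge r(\epsilon)$, $$f_{\epsilon r}\,=\,q-\sum_{j=1}^m\lambda_j\,g_j^2$$ for some sum of squares polynomial $q\in\mathbb{R}[x]$ (which may depend on $r$; the scalars $\lambda_j$ do not). In addition, for every $r\in\mathbb{N}$, $\Vert f-f_{\epsilon r}\Vert_1\to 0$ as $\epsilon\downarrow 0$.
   Context: $\mathbb{N}=\{0,1,2,\dots\}$. For $r\in\mathbb{N}$ let $\theta_r(x):=\sum_{k=0}^{r}\sum_{i=1}^n \frac{x_i^{2k}}{k!}$, and for $f\in\mathbb{R}[x]$, $\epsilon\geq 0$, let $f_{\epsilon r}:=f+\epsilon\,\theta_r$. For a polynomial $p(x)=\sum_\alpha p_\alpha x^\alpha$, $\Vert p\Vert_1:=\sum_\alpha|p_\alpha|$. A sum of squares polynomial is a finite sum of squares of elements of $\mathbb{R}[x]$. *)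

theory Defs
  imports "HOL-Analysis.Analysis" "HOL-Library.Poly_Mapping"
begin

(* Polynomials with real coefficients in the indeterminates x_i, i :: 'n, where 'n is a
   finite (hence nonempty) type with n = CARD('n) elements: finitely supported maps from
   exponent vectors to coefficients, with the convolution product of Poly_Mapping. *)
type_synonym 'n rpoly = "('n \<Rightarrow>\<^sub>0 nat) \<Rightarrow>\<^sub>0 real"

definition const_poly :: "real \<Rightarrow> 'n rpoly" where
  "const_poly c = Poly_Mapping.single 0 c"

definition var_poly :: "'n \<Rightarrow> 'n rpoly" where
  "var_poly i = Poly_Mapping.single (Poly_Mapping.single i 1) 1"

definition eval_poly :: "'n::finite rpoly \<Rightarrow> real ^ 'n \<Rightarrow> real" where
  "eval_poly p x = (\<Sum>\<alpha>\<in>Poly_Mapping.keys p.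
     Poly_Mapping.lookup p \<alpha> * (\<Prod>i\<in>UNIV. (x $ i) ^ Poly_Mapping.lookup \<alpha> i))"

definition l1_norm :: "'n rpoly \<Rightarrow> real" where
  "l1_norm p = (\<Sum>\<alpha>\<in>Poly_Mapping.keys p. \<bar>Poly_Mapping.lookup p \<alpha>\<bar>)"

definition is_sos :: "'n rpoly \<Rightarrow> bool" where
  "is_sos q \<longleftrightarrow> (\<exists>(s::nat) p :: nat \<Rightarrow> 'n rpoly. q = (\<Sum>i<s. p i ^ 2))"

definition theta :: "nat \<Rightarrow> 'n::finite rpoly" where
  "theta r = (\<Sum>k=0..r. \<Sum>i\<in>UNIV. const_poly (1 / fact k) * var_poly i ^ (2 * k))"

definition perturb :: "'n::finite rpoly \<Rightarrow> real \<Rightarrow> nat \<Rightarrow> 'n rpoly" where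
  "perturb f \<epsilon> r = f + const_poly \<epsilon> * theta r"

definition real_variety :: "nat \<Rightarrow> (nat \<Rightarrow> 'n::finite rpoly) \<Rightarrow> (real ^ 'n) set" where
  "real_variety m g = {x. \<forall>j\<in>{1..m}. eval_poly (g j) x = 0}"

end

theory Submission
  imports Defs "HOL-Probability.Sinc_Integral"
begin

text \<open>
  For large \<open>\<lambda>\<close> and \<open>k\<close> the polynomial \<open>p = f + (\<epsilon>/2) \<theta>\<^sub>k + \<lambda> \<Sum> g\<^sub>j\<^sup>2\<close> is nonnegative on the whole space: \<open>\<theta>\<^sub>k\<close> makes it
  coercive, and on a large ball the penalty \<open>\<lambda>\<close> takes over by compactness. It remains to see that \<open>p \<ge> 0\<close>
  implies that \<open>p + \<epsilon> \<theta>\<^sub>r\<close> is a sum of squares for large \<open>r\<close>.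

  To this end convolve \<open>p\<close> with the square of a bump function \<open>\<phi>\<close> of width \<open>1/A\<close>, namely a product of powers of
  \<open>sin(A t)/t\<close>. The result \<open>\<integral> p(y) \<phi>(y - x)\<^sup>2 dy\<close> is a polynomial in \<open>x\<close> of the same degree whose coefficients tend
  to those of \<open>p\<close>. Truncating the Taylor series of \<open>\<phi>(y - x)\<close> in \<open>x\<close> makes it a sum of squares, since \<open>p(y) dy\<close> is
  a positive measure. The truncation only adds terms of high degree, and because \<open>\<phi>\<close> has exponential type their
  coefficients are of order \<open>B\<^sup>g/g!\<close> in degree \<open>g\<close>; by the arithmetic-geometric mean inequality (which holds modulo
  sums of squares) such terms are dominated by \<open>\<epsilon> \<theta>\<^sub>r\<close>, whose coefficients are of order \<open>1/(g/2)!\<close>.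
\<close>

section \<open>Sums of squares\<close>

lemma const_poly_0 [simp]: "const_poly 0 = 0"
  by (simp add: const_poly_def)

lemma const_poly_1 [simp]: "const_poly 1 = 1"
  by (simp add: const_poly_def)

lemma const_poly_add: "const_poly (a + b) = const_poly a + const_poly b"
  by (simp add: const_poly_def single_add)

lemma const_poly_diff: "const_poly (a - b) = const_poly a - const_poly b"
  by (simp add: const_poly_def single_diff)

lemma const_poly_minus: "const_poly (- a) = - const_poly a"
  by (simp add: const_poly_def single_uminus)

lemma const_poly_mult: "const_poly (a * b) = const_poly a * const_poly b"
  by (simp add: const_poly_def mult_single)

lemma const_poly_sum: "const_poly (sum f A) = (\<Sum>i\<in>A. const_poly (f i))"
  by (induction A rule: infinite_finite_induct) (auto simp: const_poly_add)

lemma const_poly_mult_cancel: "a * b = 1 \<Longrightarrow> const_poly a * (const_poly b * p) = p"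
  by (metis const_poly_1 const_poly_mult mult.assoc mult_1)

lemma lookup_const_poly_mult [simp]:
  "Poly_Mapping.lookup (const_poly c * p) \<gamma> = c * Poly_Mapping.lookup p \<gamma>"
  unfolding const_poly_def mult_map_scale_conv_mult[symmetric]
  by (simp add: Poly_Mapping.map.rep_eq when_def)

lemma poly_eq_sum_single:
  assumes "finite S" "Poly_Mapping.keys p \<subseteq> S"
  shows "p = (\<Sum>\<gamma>\<in>S. Poly_Mapping.single \<gamma> (Poly_Mapping.lookup p \<gamma>))"
proof (rule poly_mapping_eqI)
  fix k
  show "Poly_Mapping.lookup p k =
      Poly_Mapping.lookup (\<Sum>\<gamma>\<in>S. Poly_Mapping.single \<gamma> (Poly_Mapping.lookup p \<gamma>)) k"
    using assms by (auto simp: lookup_sum lookup_single when_def sum.delta' in_keys_iff)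
qed

lemma var_poly_power: "var_poly i ^ k = Poly_Mapping.single (Poly_Mapping.single i k) 1"
proof (induction k)
  case (Suc k)
  have "var_poly i ^ Suc k =
      Poly_Mapping.single (Poly_Mapping.single i 1 + Poly_Mapping.single i k) 1"
    by (simp add: Suc) (simp add: var_poly_def mult_single)
  then show ?case by (metis plus_1_eq_Suc single_add)
qed simp

section \<open>Closure properties of sums of squares\<close>

lemma is_sos_0: "is_sos 0"
  unfolding is_sos_def by (rule exI[of _ 0]) simp

lemma is_sos_add_square:
  assumes "is_sos q" shows "is_sos (q + r ^ 2)"
proof -
  obtain s p where q: "q = (\<Sum>i<(s::nat). p i ^ 2)" using assms unfolding is_sos_def by auto
  have "q + r ^ 2 = (\<Sum>i<Suc s. (p(s := r)) i ^ 2)" unfolding q by simp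
  then show ?thesis unfolding is_sos_def by blast
qed

lemma is_sos_square: "is_sos (r ^ 2)"
  using is_sos_add_square[OF is_sos_0] by simp

lemma is_sos_add:
  assumes "is_sos p" "is_sos q" shows "is_sos (p + q)"
proof -
  obtain s f where q: "q = (\<Sum>i<(s::nat). f i ^ 2)" using assms unfolding is_sos_def by auto
  have "is_sos (p + (\<Sum>i<s. f i ^ 2))"
    by (induction s) (use assms is_sos_add_square in \<open>auto simp: add.assoc[symmetric]\<close>)
  then show ?thesis using q by simp
qed

lemma is_sos_sum: "(\<And>i. i \<in> A \<Longrightarrow> is_sos (f i)) \<Longrightarrow> is_sos (sum f A)"
  by (induction A rule: infinite_finite_induct) (auto simp: is_sos_0 is_sos_add)

lemma is_sos_square_mult:
  assumes "is_sos q" shows "is_sos (p ^ 2 * q)"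
proof -
  obtain s f where q: "q = (\<Sum>i<(s::nat). f i ^ 2)" using assms unfolding is_sos_def by auto
  have "p ^ 2 * q = (\<Sum>i<s. (p * f i) ^ 2)"
    by (simp add: q sum_distrib_left power_mult_distrib)
  then show ?thesis unfolding is_sos_def by (intro exI[of _ s] exI[of _ "\<lambda>i. p * f i"])
qed

lemma is_sos_mult:
  assumes "is_sos p" "is_sos q" shows "is_sos (p * q)"
proof -
  obtain s f where q: "p = (\<Sum>i<(s::nat). f i ^ 2)" using assms unfolding is_sos_def by auto
  show ?thesis
    unfolding q sum_distrib_right by (intro is_sos_sum is_sos_square_mult assms)
qed

lemma is_sos_const_mult:
  assumes "c \<ge> 0" "is_sos p" shows "is_sos (const_poly c * p)"
proof -
  have "const_poly c = const_poly (sqrt c) ^ 2"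
    using assms by (simp add: power2_eq_square const_poly_mult[symmetric])
  then show ?thesis using is_sos_square_mult assms by metis
qed

lemma is_sos_even_power: "is_sos (p ^ (2 * k))"
  using is_sos_square[of "p ^ k"] by (simp add: power_mult[symmetric] mult.commute)

section \<open>Positive semidefinite Gram matrices\<close>

lemma quadratic_nonneg_linear_coeff_0:
  fixes b c :: real
  assumes "\<And>t. 0 \<le> 2 * t * b + c" shows "b = 0"
proof (rule ccontr)
  assume "b \<noteq> 0"
  \<comment> \<open>With a nonzero slope, this value of \<open>t\<close> would push the affine
    function down to -1.\<close>
  then have "2 * (- (c + 1) / (2 * b)) * b + c = - 1" by (simp add: field_simps)
  with assms[of "- (c + 1) / (2 * b)"] show False by simp
qed

lemma sum_insert_symmetric:
  fixes h :: "'i \<Rightarrow> 'i \<Rightarrow> 'a::comm_ring_1"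
  assumes "finite I" "j \<notin> I" "\<And>\<alpha>. h \<alpha> j = h j \<alpha>"
  shows "(\<Sum>\<alpha>\<in>insert j I. \<Sum>\<beta>\<in>insert j I. h \<alpha> \<beta>) =
    h j j + 2 * (\<Sum>\<alpha>\<in>I. h j \<alpha>) + (\<Sum>\<alpha>\<in>I. \<Sum>\<beta>\<in>I. h \<alpha> \<beta>)"
proof -
  have "(\<Sum>\<alpha>\<in>I. h \<alpha> j) = (\<Sum>\<alpha>\<in>I. h j \<alpha>)"
    using assms(3) by (rule sum.cong[OF refl])
  then show ?thesis using assms(1,2) by (simp add: sum.distrib)
qed

text \<open>Completing the square in one basis element at a time.\<close>

lemma is_sos_gram:
  fixes b :: "'i \<Rightarrow> 'n rpoly"
  assumes "finite I"
    and "\<And>\<alpha> \<beta>. M \<alpha> \<beta> = M \<beta> \<alpha>"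
    and "\<And>v. 0 \<le> (\<Sum>\<alpha>\<in>I. \<Sum>\<beta>\<in>I. v \<alpha> * v \<beta> * M \<alpha> \<beta>)"
  shows "is_sos (\<Sum>\<alpha>\<in>I. \<Sum>\<beta>\<in>I. const_poly (M \<alpha> \<beta>) * (b \<alpha> * b \<beta>))"
  using assms
proof (induction I arbitrary: M rule: finite_induct)
  case empty
  then show ?case by (simp add: is_sos_0)
next
  case (insert j I)
  note sym = insert.prems(1)
  have split: "(\<Sum>\<alpha>\<in>insert j I. \<Sum>\<beta>\<in>insert j I. v \<alpha> * v \<beta> * M \<alpha> \<beta>) =
      v j ^ 2 * M j j + 2 * v j * (\<Sum>\<alpha>\<in>I. v \<alpha> * M j \<alpha>) + (\<Sum>\<alpha>\<in>I. \<Sum>\<beta>\<in>I. v \<alpha> * v \<beta> * M \<alpha> \<beta>)" for v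
  proof -
    have "v \<alpha> * v j * M \<alpha> j = v j * v \<alpha> * M j \<alpha>" for \<alpha>
      using sym[of \<alpha> j] by simp
    from sum_insert_symmetric[where h = "\<lambda>\<alpha> \<beta>. v \<alpha> * v \<beta> * M \<alpha> \<beta>", OF insert.hyps this] show ?thesis
      by (simp add: sum_distrib_left power2_eq_square mult_ac)
  qed
  have splitp: "(\<Sum>\<alpha>\<in>insert j I. \<Sum>\<beta>\<in>insert j I. const_poly (M \<alpha> \<beta>) * (b \<alpha> * b \<beta>)) =
      const_poly (M j j) * b j ^ 2 + 2 * b j * (\<Sum>\<alpha>\<in>I. const_poly (M j \<alpha>) * b \<alpha>) +
      (\<Sum>\<alpha>\<in>I. \<Sum>\<beta>\<in>I. const_poly (M \<alpha> \<beta>) * (b \<alpha> * b \<beta>))"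
  proof -
    have "const_poly (M \<alpha> j) * (b \<alpha> * b j) = const_poly (M j \<alpha>) * (b j * b \<alpha>)" for \<alpha>
      using sym[of \<alpha> j] by (simp add: mult_ac)
    from sum_insert_symmetric[where h = "\<lambda>\<alpha> \<beta>. const_poly (M \<alpha> \<beta>) * (b \<alpha> * b \<beta>)", OF insert.hyps this] show ?thesis
      by (simp add: sum_distrib_left power2_eq_square mult_ac)
  qed
  have Mjj: "0 \<le> M j j"
  proof -
    have z: "(\<Sum>\<alpha>\<in>I. (if \<alpha> = j then 1 else 0) * g \<alpha>) = (0::real)" for g
      using insert.hyps by (intro sum.neutral) auto
    show ?thesis
      using insert.prems(2)[of "\<lambda>\<alpha>. if \<alpha> = j then 1 else 0"]
      unfolding split unfolding mult.assoc sum_distrib_left[symmetric] z by simp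
  qed
  show ?case
  proof (cases "M j j = 0")
    \<comment> \<open>A zero pivot: positivity forces the whole row of \<open>j\<close> to vanish,
      so only the Gram sum over \<open>I\<close> remains.\<close>
    case True
    have PSD: "0 \<le> (\<Sum>\<alpha>\<in>I. \<Sum>\<beta>\<in>I. v \<alpha> * v \<beta> * M \<alpha> \<beta>)" for v
    proof -
      have "(\<Sum>\<alpha>\<in>I. (v(j := 0)) \<alpha> * g \<alpha>) = (\<Sum>\<alpha>\<in>I. v \<alpha> * g \<alpha>)" for g
        using insert.hyps by (intro sum.cong) auto
      then show ?thesis
        using insert.prems(2)[of "v(j := 0)"]
        unfolding split unfolding mult.assoc sum_distrib_left[symmetric] by simp
    qed
    have "M j \<alpha> = 0" if "\<alpha> \<in> I" for \<alpha>
    proof (rule quadratic_nonneg_linear_coeff_0)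
      fix t :: real
      \<comment> \<open>The test vector is the unit vector at \<alpha> plus \<open>t\<close> times
        the unit vector at \<open>j\<close>. Since \<open>M j j = 0\<close>, the form is affine in
        \<open>t\<close>.\<close>
      define v where "v = (\<lambda>\<beta>. if \<beta> = \<alpha> then 1 else if \<beta> = j then t else 0)"
      have v: "(\<Sum>\<beta>\<in>I. v \<beta> * g \<beta>) = g \<alpha>" for g
      proof -
        have "(\<Sum>\<beta>\<in>I. v \<beta> * g \<beta>) = (\<Sum>\<beta>\<in>I. if \<beta> = \<alpha> then g \<beta> else 0)"
          using insert.hyps by (intro sum.cong) (auto simp: v_def)
        then show ?thesis using that insert.hyps by (simp add: sum.delta)
      qed
      have "v j = t" using that insert.hyps by (auto simp: v_def)
      then show "0 \<le> 2 * t * M j \<alpha> + M \<alpha> \<alpha>"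
        using insert.prems(2)[of v] unfolding split unfolding mult.assoc sum_distrib_left[symmetric] v
        by (simp add: True)
    qed
    moreover have "is_sos (\<Sum>\<alpha>\<in>I. \<Sum>\<beta>\<in>I. const_poly (M \<alpha> \<beta>) * (b \<alpha> * b \<beta>))"
      by (rule insert.IH[OF sym PSD])
    ultimately show ?thesis unfolding splitp by (simp add: True)
  next
    case False
    define d where "d = M j j"
    have d: "d > 0" using False Mjj by (simp add: d_def)
    \<comment> \<open>The Schur complement of the pivot \<open>d\<close>.\<close>
    define M' where "M' = (\<lambda>\<alpha> \<beta>. M \<alpha> \<beta> - M j \<alpha> * M j \<beta> / d)"
    have symM': "M' \<alpha> \<beta> = M' \<beta> \<alpha>" for \<alpha> \<beta> unfolding M'_def using sym[of \<alpha> \<beta>] by simp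
    have "0 \<le> (\<Sum>\<alpha>\<in>I. \<Sum>\<beta>\<in>I. v \<alpha> * v \<beta> * M' \<alpha> \<beta>)" for v
    proof -
      define s where "s = (\<Sum>\<alpha>\<in>I. v \<alpha> * M j \<alpha>)"
      \<comment> \<open>This value of coordinate \<open>j\<close> minimises the form of
        \<open>M\<close> when the other coordinates are fixed; the minimum is the form of the Schur
        complement.\<close>
      define w where "w = v(j := - s / d)"
      have w: "(\<Sum>\<alpha>\<in>I. w \<alpha> * g \<alpha>) = (\<Sum>\<alpha>\<in>I. v \<alpha> * g \<alpha>)" for g
        using insert.hyps by (intro sum.cong) (auto simp: w_def)
      have "0 \<le> w j ^ 2 * d + 2 * w j * s + (\<Sum>\<alpha>\<in>I. \<Sum>\<beta>\<in>I. v \<alpha> * v \<beta> * M \<alpha> \<beta>)"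
        using insert.prems(2)[of w] unfolding split unfolding mult.assoc sum_distrib_left[symmetric] w
        by (simp add: s_def d_def)
      also have "w j ^ 2 * d + 2 * w j * s = - (s * s / d)"
        using d by (simp add: w_def power2_eq_square field_simps)
      also have "s * s / d = (\<Sum>\<alpha>\<in>I. \<Sum>\<beta>\<in>I. v \<alpha> * v \<beta> * (M j \<alpha> * M j \<beta> / d))"
        unfolding s_def sum_product sum_divide_distrib by (simp add: algebra_simps)
      finally show ?thesis by (simp add: M'_def sum_subtractf algebra_simps)
    qed
    then have 1: "is_sos (\<Sum>\<alpha>\<in>I. \<Sum>\<beta>\<in>I. const_poly (M' \<alpha> \<beta>) * (b \<alpha> * b \<beta>))"
      by (rule insert.IH[OF symM'])
    define S where "S = (\<Sum>\<alpha>\<in>I. const_poly (M j \<alpha>) * b \<alpha>)"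
    \<comment> \<open>The completed square. Expanded, it gives the pivot and cross terms plus
      \<open>S ^ 2 / d\<close>, which is exactly what the Schur complement has subtracted.\<close>
    have 2: "is_sos (const_poly (1 / d) * (const_poly d * b j + S) ^ 2)"
      using d by (intro is_sos_const_mult is_sos_square) auto
    have "(\<Sum>\<alpha>\<in>I. \<Sum>\<beta>\<in>I. const_poly (M \<alpha> \<beta>) * (b \<alpha> * b \<beta>)) =
        (\<Sum>\<alpha>\<in>I. \<Sum>\<beta>\<in>I. const_poly (M' \<alpha> \<beta>) * (b \<alpha> * b \<beta>)) + const_poly (1 / d) * S ^ 2"
    proof -
      have "const_poly (1 / d) * S ^ 2 =
        (\<Sum>\<alpha>\<in>I. \<Sum>\<beta>\<in>I. const_poly (M j \<alpha> * M j \<beta> / d) * (b \<alpha> * b \<beta>))"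
      proof -
        have "const_poly (M j \<alpha> * M j \<beta> / d) = const_poly (1 / d) * (const_poly (M j \<alpha>) * const_poly (M j \<beta>) :: 'n rpoly)"
          for \<alpha> \<beta> by (simp add: const_poly_mult[symmetric])
        moreover have "S ^ 2 = (\<Sum>\<alpha>\<in>I. \<Sum>\<beta>\<in>I. const_poly (M j \<alpha>) * b \<alpha> * (const_poly (M j \<beta>) * b \<beta>))"
          by (simp add: S_def power2_eq_square sum_product)
        ultimately show ?thesis by (simp add: sum_distrib_left mult_ac)
      qed
      moreover have "const_poly (M \<alpha> \<beta>) =
          const_poly (M' \<alpha> \<beta>) + (const_poly (M j \<alpha> * M j \<beta> / d) :: 'n rpoly)" for \<alpha> \<beta>
        by (simp add: M'_def const_poly_add[symmetric])
      ultimately show ?thesis by (simp add: distrib_right sum.distrib)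
    qed
    moreover have "const_poly (1 / d) * (const_poly d * b j + S) ^ 2 =
        const_poly d * b j ^ 2 + 2 * b j * S + const_poly (1 / d) * S ^ 2"
    proof -
      have 1: "const_poly (1 / d) * const_poly d = 1"
        using d by (simp add: const_poly_mult[symmetric])
      have "const_poly (1 / d) * (const_poly d * b j + S) ^ 2 =
        (const_poly (1 / d) * const_poly d) * const_poly d * b j ^ 2
        + 2 * (const_poly (1 / d) * const_poly d) * b j * S + const_poly (1 / d) * S ^ 2"
        by (simp add: power2_eq_square algebra_simps)
      then show ?thesis unfolding 1 by simp
    qed
    ultimately have "(\<Sum>\<alpha>\<in>insert j I. \<Sum>\<beta>\<in>insert j I. const_poly (M \<alpha> \<beta>) * (b \<alpha> * b \<beta>)) =
        (\<Sum>\<alpha>\<in>I. \<Sum>\<beta>\<in>I. const_poly (M' \<alpha> \<beta>) * (b \<alpha> * b \<beta>)) +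
        const_poly (1 / d) * (const_poly d * b j + S) ^ 2"
      unfolding splitp d_def[symmetric] S_def[symmetric] by simp
    then show ?thesis using is_sos_add[OF 1 2] by simp
  qed
qed

text \<open>Both \<open>u ^ (2 * a) - v ^ (2 * a)\<close> and
  \<open>u ^ (2 * b) - v ^ (2 * b)\<close> are \<open>u ^ 2 - v ^ 2\<close> times a sum of squares,
  so their product is a sum of squares. Adding the square of \<open>u ^ b * v ^ a\<close> cancels
  one of the two mixed terms and leaves the other.\<close>

lemma is_sos_two_term_amgm:
  "is_sos (u ^ (2 * (a + b)) + v ^ (2 * (a + b)) - u ^ (2 * a) * v ^ (2 * b))"
proof -
  have S: "is_sos (\<Sum>i<m. (v ^ 2) ^ (m - Suc i) * (u ^ 2) ^ i)" for m
  proof (intro is_sos_sum)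
    fix i
    show "is_sos ((v ^ 2) ^ (m - Suc i) * (u ^ 2) ^ i)"
      using is_sos_square[of "v ^ (m - Suc i) * u ^ i"]
      by (simp add: power_mult_distrib power_mult[symmetric] mult.commute)
  qed
  have D: "u ^ (2 * m) - v ^ (2 * m) = (u ^ 2 - v ^ 2) * (\<Sum>i<m. (v ^ 2) ^ (m - Suc i) * (u ^ 2) ^ i)" for m
    using power_diff_sumr2[of "u ^ 2" m "v ^ 2"] by (simp only: power_mult)
  have "is_sos ((u ^ 2 - v ^ 2) ^ 2 * ((\<Sum>i<a. (v ^ 2) ^ (a - Suc i) * (u ^ 2) ^ i) *
      (\<Sum>i<b. (v ^ 2) ^ (b - Suc i) * (u ^ 2) ^ i)))"
    by (intro is_sos_square_mult is_sos_mult S)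
  also have "(u ^ 2 - v ^ 2) ^ 2 * ((\<Sum>i<a. (v ^ 2) ^ (a - Suc i) * (u ^ 2) ^ i) *
      (\<Sum>i<b. (v ^ 2) ^ (b - Suc i) * (u ^ 2) ^ i)) =
      (u ^ (2 * a) - v ^ (2 * a)) * (u ^ (2 * b) - v ^ (2 * b))"
    unfolding D by (simp only: power2_eq_square mult_ac)
  finally have "is_sos ((u ^ (2 * a) - v ^ (2 * a)) * (u ^ (2 * b) - v ^ (2 * b)) + (u ^ b * v ^ a) ^ 2)"
    by (rule is_sos_add_square)
  also have "(u ^ (2 * a) - v ^ (2 * a)) * (u ^ (2 * b) - v ^ (2 * b)) + (u ^ b * v ^ a) ^ 2 =
      u ^ (2 * (a + b)) + v ^ (2 * (a + b)) - u ^ (2 * a) * v ^ (2 * b)"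
    by (simp add: power_mult_distrib power_mult[symmetric] power_add algebra_simps)
  finally show ?thesis .
qed

text \<open>Induction on \<open>F\<close>: multiply the inequality for \<open>F\<close> by the new
  factor \<open>x j ^ (2 * a j)\<close> and apply the two-term case to each product that appears.
  Each step multiplies the constant by the new cardinality, whence the factorial.\<close>

lemma is_sos_amgm:
  fixes x :: "'i \<Rightarrow> 'n rpoly" and a :: "'i \<Rightarrow> nat"
  assumes "finite F" "F \<noteq> {}"
  shows "is_sos (const_poly (fact (card F)) * (\<Sum>i\<in>F. x i ^ (2 * sum a F)) - (\<Prod>i\<in>F. x i ^ (2 * a i)))"
  using assms
proof (induction F rule: finite_ne_induct)
  case (singleton j)
  then show ?case by (simp add: is_sos_0)
next
  case (insert j F)
  define k where "k = sum a F"
  define S where "S = (\<Sum>i\<in>F. x i ^ (2 * (a j + k)))"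
  define c :: real where "c = fact (card F)"
  define m :: real where "m = card F"
  have sumS: "(\<Sum>i\<in>F. x j ^ (2 * (a j + k)) + x i ^ (2 * (a j + k)) - x j ^ (2 * a j) * x i ^ (2 * k)) =
      const_poly m * x j ^ (2 * (a j + k)) + S - x j ^ (2 * a j) * (\<Sum>i\<in>F. x i ^ (2 * k))"
    by (simp add: sum.distrib sum_subtractf S_def m_def sum_distrib_left const_poly_def)
  have "is_sos (x j ^ (2 * a j) *
      (const_poly c * (\<Sum>i\<in>F. x i ^ (2 * k)) - (\<Prod>i\<in>F. x i ^ (2 * a i))))"
    using insert.IH by (intro is_sos_mult is_sos_even_power) (simp add: c_def k_def)
  moreover have "is_sos (const_poly c * (\<Sum>i\<in>F. x j ^ (2 * (a j + k)) + x i ^ (2 * (a j + k)) -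
      x j ^ (2 * a j) * x i ^ (2 * k)))"
    by (intro is_sos_const_mult is_sos_sum is_sos_two_term_amgm) (simp add: c_def)
  \<comment> \<open>So far the power of \<open>x j\<close> has coefficient \<open>c * m\<close> and
    \<open>S\<close> has coefficient \<open>c\<close>; this padding brings both to
    \<open>(m + 1) * c\<close>.\<close>
  moreover have "is_sos (const_poly c * x j ^ (2 * (a j + k)) + const_poly (c * m) * S)"
    unfolding S_def
    by (intro is_sos_add is_sos_const_mult is_sos_sum is_sos_even_power) (auto simp: c_def m_def)
  ultimately have "is_sos (x j ^ (2 * a j) *
      (const_poly c * (\<Sum>i\<in>F. x i ^ (2 * k)) - (\<Prod>i\<in>F. x i ^ (2 * a i))) +
      const_poly c * (\<Sum>i\<in>F. x j ^ (2 * (a j + k)) + x i ^ (2 * (a j + k)) -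
      x j ^ (2 * a j) * x i ^ (2 * k)) +
      (const_poly c * x j ^ (2 * (a j + k)) + const_poly (c * m) * S))"
    by (rule is_sos_add[OF is_sos_add])
  also have "x j ^ (2 * a j) *
      (const_poly c * (\<Sum>i\<in>F. x i ^ (2 * k)) - (\<Prod>i\<in>F. x i ^ (2 * a i))) +
      const_poly c * (\<Sum>i\<in>F. x j ^ (2 * (a j + k)) + x i ^ (2 * (a j + k)) -
      x j ^ (2 * a j) * x i ^ (2 * k)) +
      (const_poly c * x j ^ (2 * (a j + k)) + const_poly (c * m) * S) =
      const_poly ((m + 1) * c) * (x j ^ (2 * (a j + k)) + S) - x j ^ (2 * a j) * (\<Prod>i\<in>F. x i ^ (2 * a i))"
    unfolding sumS by (simp add: const_poly_mult const_poly_add algebra_simps)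
  also have "(m + 1) * c = fact (card (insert j F))"
    using insert.hyps by (simp add: m_def c_def)
  finally show ?case
    using insert.hyps by (simp add: S_def k_def)
qed

section \<open>Perturbations dominated by theta\<close>

definition mdeg :: "('n::finite \<Rightarrow>\<^sub>0 nat) \<Rightarrow> nat" where
  "mdeg \<gamma> = (\<Sum>i\<in>UNIV. Poly_Mapping.lookup \<gamma> i)"

lemma mdeg_add: "mdeg (\<alpha> + \<beta>) = mdeg \<alpha> + mdeg \<beta>"
  by (simp add: mdeg_def lookup_add sum.distrib)

lemma mdeg_single [simp]: "mdeg (Poly_Mapping.single i k) = k"
  by (simp add: mdeg_def lookup_single when_def)

text \<open>Needed to write a monomial as a product of two monomials of nearly equal degree, and so
  as the cross term of a square.\<close>

lemma exponent_split:
  assumes "m \<le> mdeg \<gamma>"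
  obtains \<alpha> \<beta> where "\<gamma> = \<alpha> + \<beta>" "mdeg \<alpha> = m"
proof -
  have "\<exists>\<alpha> \<beta>. \<gamma> = \<alpha> + \<beta> \<and> mdeg \<alpha> = m" using assms
  proof (induction m)
    case 0
    show ?case by (rule exI[of _ 0], rule exI[of _ \<gamma>]) (simp add: mdeg_def)
  next
    case (Suc m)
    then obtain \<alpha> \<beta> where ab: "\<gamma> = \<alpha> + \<beta>" "mdeg \<alpha> = m" by auto
    have "mdeg \<beta> \<noteq> 0" using ab Suc.prems by (auto simp: mdeg_add)
    then obtain i where i: "Poly_Mapping.lookup \<beta> i \<noteq> 0" by (auto simp: mdeg_def)
    have "\<beta> = Poly_Mapping.single i 1 + (\<beta> - Poly_Mapping.single i 1)"
      using i by (intro poly_mapping_eqI) (auto simp: lookup_add lookup_minus lookup_single when_def)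
    then have "\<gamma> = (\<alpha> + Poly_Mapping.single i 1) + (\<beta> - Poly_Mapping.single i 1)"
      using ab by (simp add: add.assoc)
    moreover have "mdeg (\<alpha> + Poly_Mapping.single i 1) = Suc m" using ab by (simp add: mdeg_add)
    ultimately show ?case by blast
  qed
  then show ?thesis using that by blast
qed

lemma prod_single:
  "finite A \<Longrightarrow> (\<Prod>i\<in>A. Poly_Mapping.single (f i :: 'n \<Rightarrow>\<^sub>0 nat) (1::real)) = Poly_Mapping.single (\<Sum>i\<in>A. f i) 1"
  by (induction A rule: finite_induct) (auto simp: mult_single)

lemma exponent_eq_sum_single:
  "(\<alpha> :: 'n::finite \<Rightarrow>\<^sub>0 nat) = (\<Sum>i\<in>UNIV. Poly_Mapping.single i (Poly_Mapping.lookup \<alpha> i))"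
  by (rule poly_mapping_eqI) (simp add: lookup_sum lookup_single when_def)

lemma single_eq_prod_var_poly:
  "Poly_Mapping.single (\<alpha> :: 'n::finite \<Rightarrow>\<^sub>0 nat) 1 = (\<Prod>i\<in>UNIV. var_poly i ^ Poly_Mapping.lookup \<alpha> i)"
  by (simp add: var_poly_power prod_single exponent_eq_sum_single[symmetric])

section \<open>Power sums and the perturbation theta\<close>

definition power_sum :: "nat \<Rightarrow> 'n::finite rpoly" where
  "power_sum k = (\<Sum>i\<in>UNIV. var_poly i ^ (2 * k))"

lemma theta_eq: "theta r = (\<Sum>k\<le>r. const_poly (1 / fact k) * power_sum k)"
  by (simp add: theta_def power_sum_def sum_distrib_left atMost_atLeast0)

lemma is_sos_power_sum: "is_sos (power_sum k)"
  unfolding power_sum_def by (intro is_sos_sum is_sos_even_power)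

lemma is_sos_theta: "is_sos (theta r)"
  unfolding theta_eq by (intro is_sos_sum is_sos_const_mult is_sos_power_sum) auto

text \<open>Lets a fixed truncation be replaced by any later one, which in the end makes all
  perturbation terms have the same index \<open>r\<close>.\<close>

lemma is_sos_theta_diff:
  assumes "k \<le> r" shows "is_sos (theta r - theta k :: 'n::finite rpoly)"
proof -
  have "(\<Sum>j\<le>r. const_poly (1 / fact j) * power_sum j) =
    (\<Sum>j\<le>k. const_poly (1 / fact j) * power_sum j) + (\<Sum>j\<in>{k<..r}. const_poly (1 / fact j) * power_sum j :: 'n rpoly)"
    using assms by (subst sum.union_disjoint[symmetric]) (auto intro!: sum.cong)
  then have "theta r - theta k = (\<Sum>j\<in>{k<..r}. const_poly (1 / fact j) * power_sum j :: 'n rpoly)"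
    by (simp add: theta_eq)
  then show ?thesis
    by (auto intro!: is_sos_sum is_sos_const_mult is_sos_power_sum)
qed

text \<open>\<open>theta r\<close> contains \<open>power_sum k\<close> with coefficient
  \<open>1 / fact k\<close>, and its other terms are sums of squares. Allowing any larger
  \<open>c\<close> lets one constant serve two different degrees.\<close>

lemma is_sos_fact_theta_minus_power_sum:
  assumes "k \<le> r" "c \<ge> fact k"
  shows "is_sos (const_poly c * theta r - power_sum k :: 'n::finite rpoly)"
proof -
  have "theta r = const_poly (1 / fact k) * power_sum k +
      (\<Sum>j\<in>{..r} - {k}. const_poly (1 / fact j) * power_sum j :: 'n rpoly)"
    unfolding theta_eq using assms by (subst sum.remove[of _ k]) auto
  then have "const_poly (fact k) * theta r - power_sum k =
      const_poly (fact k) * (\<Sum>j\<in>{..r} - {k}. const_poly (1 / fact j) * power_sum j :: 'n rpoly)"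
    by (simp add: distrib_left const_poly_mult_cancel)
  moreover have "is_sos (const_poly (fact k) * (\<Sum>j\<in>{..r} - {k}. const_poly (1 / fact j) * power_sum j ::'n rpoly))"
    by (intro is_sos_const_mult is_sos_sum is_sos_power_sum) auto
  moreover have "is_sos (const_poly (c - fact k) * theta r :: 'n rpoly)"
    using assms by (intro is_sos_const_mult is_sos_theta) auto
  ultimately have "is_sos ((const_poly (fact k) * theta r - power_sum k) + const_poly (c - fact k) * theta r :: 'n rpoly)"
    by (metis is_sos_add)
  then show ?thesis by (simp add: const_poly_diff algebra_simps)
qed

text \<open>The arithmetic-geometric mean inequality over all variables, with the entries of
  \<alpha> as exponents.\<close>

lemma is_sos_power_sum_minus_monomial:
  fixes \<alpha> :: "'n::finite \<Rightarrow>\<^sub>0 nat"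
  shows "is_sos (const_poly (fact CARD('n)) * power_sum (mdeg \<alpha>) - Poly_Mapping.single \<alpha> 1 ^ 2)"
  using is_sos_amgm[of "UNIV :: 'n set" var_poly "Poly_Mapping.lookup \<alpha>"]
  unfolding single_eq_prod_var_poly power_sum_def mdeg_def
  by (simp add: prod_power_distrib power_mult[symmetric] mult.commute)

text \<open>Up to a constant depending on the dimension only, this is the multiple of theta that
  absorbs a monomial with coefficient 1 or -1. The half degree is rounded up because the larger of
  the two half monomials decides.\<close>

definition mweight :: "('n::finite \<Rightarrow>\<^sub>0 nat) \<Rightarrow> real" where
  "mweight \<gamma> = fact ((mdeg \<gamma> + 1) div 2)"

text \<open>Split the monomial into halves \<open>X\<close> and \<open>Y\<close>. It is the cross
  term of \<open>\<bar>c\<bar> / 2\<close> times the square of \<open>X + sgn c * Y\<close>; the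
  squares of \<open>X\<close> and \<open>Y\<close> are absorbed by power sums, and those by
  theta.\<close>

lemma is_sos_theta_plus_monomial:
  fixes \<gamma> :: "'n::finite \<Rightarrow>\<^sub>0 nat"
  assumes "mdeg \<gamma> \<le> 2 * r"
  shows "is_sos (const_poly (fact CARD('n) * (\<bar>c\<bar> * mweight \<gamma>)) * theta r + Poly_Mapping.single \<gamma> c)"
proof -
  obtain \<alpha> \<beta> where ab: "\<gamma> = \<alpha> + \<beta>" "mdeg \<alpha> = mdeg \<gamma> div 2"
    using exponent_split[of "mdeg \<gamma> div 2" \<gamma>] by auto
  have b: "mdeg \<beta> = (mdeg \<gamma> + 1) div 2" using mdeg_add[of \<alpha> \<beta>] unfolding ab(2) ab(1)[symmetric] by linarith
  define X where "X = (Poly_Mapping.single \<alpha> 1 :: 'n rpoly)"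
  define Y where "Y = (Poly_Mapping.single \<beta> 1 :: 'n rpoly)"
  define P where "P = (power_sum (mdeg \<alpha>) :: 'n rpoly)"
  define Q where "Q = (power_sum (mdeg \<beta>) :: 'n rpoly)"
  define N :: real where "N = fact CARD('n)"
  have "(fact (mdeg \<alpha>) :: real) \<le> fact (mdeg \<beta>)" using ab b by (intro fact_mono) auto
  then have "is_sos (const_poly (mweight \<gamma>) * theta r - P)" "is_sos (const_poly (mweight \<gamma>) * theta r - Q)"
    unfolding P_def Q_def mweight_def b[symmetric] using assms ab b
    by (auto intro!: is_sos_fact_theta_minus_power_sum)
  then have 1: "is_sos (const_poly (\<bar>c\<bar> / 2) * (const_poly N * (const_poly (mweight \<gamma>) * theta r - P)
      + const_poly N * (const_poly (mweight \<gamma>) * theta r - Q)))"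
    by (intro is_sos_const_mult is_sos_add) (auto simp: N_def)
  have 2: "is_sos (const_poly (\<bar>c\<bar> / 2) * ((const_poly N * P - X ^ 2) + (const_poly N * Q - Y ^ 2)))"
    unfolding N_def P_def Q_def X_def Y_def
    by (intro is_sos_const_mult is_sos_add is_sos_power_sum_minus_monomial) auto
  have 3: "is_sos (const_poly (\<bar>c\<bar> / 2) * (X + const_poly (sgn c) * Y) ^ 2)"
    by (intro is_sos_const_mult is_sos_square) auto
  have "const_poly (\<bar>c\<bar> / 2) * (X + const_poly (sgn c) * Y) ^ 2 =
      const_poly (\<bar>c\<bar> / 2) * X ^ 2 + const_poly (\<bar>c\<bar> / 2 * sgn c * 2) * X * Y + const_poly (\<bar>c\<bar> / 2 * sgn c * sgn c) * Y ^ 2"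
    unfolding const_poly_mult by (simp add: const_poly_def power2_eq_square algebra_simps)
  also have "\<bar>c\<bar> / 2 * sgn c * 2 = c" by (simp add: abs_mult_sgn)
  also have "\<bar>c\<bar> / 2 * sgn c * sgn c = \<bar>c\<bar> / 2" by (auto simp: sgn_if)
  also have "const_poly c * X * Y = Poly_Mapping.single \<gamma> c"
    by (simp add: X_def Y_def ab const_poly_def mult_single)
  finally have "const_poly (\<bar>c\<bar> / 2) * X ^ 2 + Poly_Mapping.single \<gamma> c + const_poly (\<bar>c\<bar> / 2) * Y ^ 2 =
      const_poly (\<bar>c\<bar> / 2) * (X + const_poly (sgn c) * Y) ^ 2" by simp
  with 3 have 3: "is_sos (const_poly (\<bar>c\<bar> / 2) * X ^ 2 + Poly_Mapping.single \<gamma> c + const_poly (\<bar>c\<bar> / 2) * Y ^ 2)"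
    by simp
  have "const_poly (N * (\<bar>c\<bar> * mweight \<gamma>)) =
      const_poly (\<bar>c\<bar> / 2) * (const_poly N * const_poly (mweight \<gamma>)) + const_poly (\<bar>c\<bar> / 2) * (const_poly N * const_poly (mweight \<gamma>) :: 'n rpoly)"
    by (simp add: const_poly_mult[symmetric] const_poly_add[symmetric])
  then have "const_poly (N * (\<bar>c\<bar> * mweight \<gamma>)) * theta r + Poly_Mapping.single \<gamma> c =
      const_poly (\<bar>c\<bar> / 2) * (const_poly N * (const_poly (mweight \<gamma>) * theta r - P)
      + const_poly N * (const_poly (mweight \<gamma>) * theta r - Q)) +
      const_poly (\<bar>c\<bar> / 2) * ((const_poly N * P - X ^ 2) + (const_poly N * Q - Y ^ 2)) +
      (const_poly (\<bar>c\<bar> / 2) * X ^ 2 + Poly_Mapping.single \<gamma> c + const_poly (\<bar>c\<bar> / 2) * Y ^ 2)"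
    by (simp add: algebra_simps)
  then show ?thesis unfolding N_def[symmetric] by (metis 1 2 3 is_sos_add)
qed

text \<open>The monomial case summed up. The set \<open>S\<close> may exceed the support, so that a
  whole box of exponents can be taken.\<close>

lemma is_sos_theta_plus_poly:
  fixes e :: "'n::finite rpoly"
  assumes "finite S" "Poly_Mapping.keys e \<subseteq> S" "\<And>\<gamma>. \<gamma> \<in> S \<Longrightarrow> mdeg \<gamma> \<le> 2 * r"
    and "fact CARD('n) * (\<Sum>\<gamma>\<in>S. \<bar>Poly_Mapping.lookup e \<gamma>\<bar> * mweight \<gamma>) \<le> c"
  shows "is_sos (const_poly c * theta r + e)"
proof -
  let ?w = "fact CARD('n) * (\<Sum>\<gamma>\<in>S. \<bar>Poly_Mapping.lookup e \<gamma>\<bar> * mweight \<gamma>)"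
  have "is_sos (\<Sum>\<gamma>\<in>S. const_poly (fact CARD('n) * (\<bar>Poly_Mapping.lookup e \<gamma>\<bar> * mweight \<gamma>)) * theta r +
      Poly_Mapping.single \<gamma> (Poly_Mapping.lookup e \<gamma>))"
    by (intro is_sos_sum is_sos_theta_plus_monomial assms)
  also have "\<dots> = const_poly ?w * theta r + e"
    using poly_eq_sum_single[OF assms(1,2)]
    by (simp add: sum.distrib sum_distrib_left sum_distrib_right const_poly_sum)
  finally have "is_sos (const_poly ?w * theta r + e)" .
  moreover have "is_sos (const_poly (c - ?w) * theta r :: 'n rpoly)"
    using assms by (intro is_sos_const_mult is_sos_theta) auto
  ultimately have "is_sos ((const_poly ?w * theta r + e) + const_poly (c - ?w) * theta r)"
    by (rule is_sos_add)
  then show ?thesis by (simp add: const_poly_diff algebra_simps)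
qed

section \<open>Kernels with Taylor coefficients of exponential type\<close>

text \<open>Strong induction: once the lower coefficients vanish, dividing by \<open>x ^ n\<close>
  gives a series that is zero for every nonzero \<open>x\<close> and whose limit at 0 is
  \<open>d n\<close>.\<close>

lemma powser_zero_coeffs:
  fixes d :: "nat \<Rightarrow> real"
  assumes "\<And>x. (\<lambda>n. d n * x ^ n) sums 0"
  shows "d n = 0"
proof (induction n rule: less_induct)
  case (less n)
  have "(\<lambda>m. d (m + n) * x ^ m) sums 0" if "x \<noteq> 0" for x
  proof -
    have "(\<lambda>m. d (m + n) * x ^ (m + n)) sums (0 - (\<Sum>i<n. d i * x ^ i))"
      using assms[of x] by (subst sums_iff_shift) simp
    then have "(\<lambda>m. inverse (x ^ n) * (d (m + n) * x ^ (m + n))) sums (inverse (x ^ n) * 0)"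
      using less by (intro sums_mult) simp
    moreover have "inverse (x ^ n) * (d (m + n) * x ^ (m + n)) = d (m + n) * x ^ m" for m
      using that by (simp add: power_add)
    ultimately show ?thesis by simp
  qed
  then have "((\<lambda>x. 0) \<longlongrightarrow> d (0 + n)) (at (0::real))"
    by (intro powser_limit_0_strong[where s = 1]) auto
  then have "0 = d (0 + n)" by (rule tendsto_unique[OF trivial_limit_at tendsto_const])
  then show ?case by simp
qed

text \<open>Used to identify moments from two expansions of one function, without evaluating the
  integrals of the individual Taylor coefficients.\<close>

lemma powser_coeffs_unique:
  fixes c d :: "nat \<Rightarrow> real"
  assumes "\<And>x. (\<lambda>n. c n * x ^ n) sums f x" "\<And>x. (\<lambda>n. d n * x ^ n) sums f x"
  shows "c n = d n"
proof -
  have "(\<lambda>n. (c n - d n) * x ^ n) sums 0" for x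
    using sums_diff[OF assms(1)[of x] assms(2)[of x]] by (simp add: algebra_simps)
  from powser_zero_coeffs[of "\<lambda>n. c n - d n", OF this, of n] show ?thesis by simp
qed

text \<open>\<open>c a y\<close> is the Taylor coefficient of degree \<open>a\<close> in the
  translation parameter \<open>x\<close>. The last condition separates the exponential type
  \<open>B\<close> from the decay \<open>v\<close> in \<open>y\<close>, because the two behave
  differently under products: types add, weights multiply.\<close>

definition taylor_kernel ::
    "(real \<Rightarrow> real) \<Rightarrow> (nat \<Rightarrow> real \<Rightarrow> real) \<Rightarrow> real \<Rightarrow> (real \<Rightarrow> real) \<Rightarrow> bool" where
  "taylor_kernel S c B v \<longleftrightarrow> 0 \<le> B \<and> (\<forall>a. continuous_on UNIV (c a)) \<and>
     (\<forall>x y. (\<lambda>a. c a y * x ^ a) sums S (y - x)) \<and> (\<forall>a y. \<bar>c a y\<bar> \<le> B ^ a / fact a * v y)"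

lemma summable_exp_real: "summable (\<lambda>a. (x::real) ^ a / fact a)"
  using summable_exp[of x] by (simp add: divide_inverse mult.commute)

lemma taylor_kernel_summable:
  assumes "taylor_kernel S c B v"
  shows "summable (\<lambda>a. norm (c a y * x ^ a))"
proof (rule summable_comparison_test')
  show "summable (\<lambda>a. v y * ((B * \<bar>x\<bar>) ^ a / fact a))"
    by (intro summable_mult summable_exp_real)
  fix a :: nat
  have "\<bar>c a y\<bar> * \<bar>x\<bar> ^ a \<le> (B ^ a / fact a * v y) * \<bar>x\<bar> ^ a"
    using assms by (intro mult_right_mono) (auto simp: taylor_kernel_def)
  then show "norm (norm (c a y * x ^ a)) \<le> v y * ((B * \<bar>x\<bar>) ^ a / fact a)"
    by (simp add: abs_mult power_abs power_mult_distrib mult_ac)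
qed

lemma sum_exp_coeffs:
  fixes x y :: real
  shows "(\<Sum>i\<le>n. x ^ i / fact i * (y ^ (n - i) / fact (n - i))) = (x + y) ^ n / fact n"
  unfolding binomial_ring sum_divide_distrib
  by (intro sum.cong refl) (simp add: binomial_fact)

text \<open>The coefficients are those of the Cauchy product, and the bound for them is the binomial
  theorem divided by \<open>fact a\<close>.\<close>

lemma taylor_kernel_mult:
  assumes 1: "taylor_kernel S1 c1 B1 v1" and 2: "taylor_kernel S2 c2 B2 v2"
  shows "taylor_kernel (\<lambda>u. S1 u * S2 u) (\<lambda>a y. \<Sum>i\<le>a. c1 i y * c2 (a - i) y) (B1 + B2) (\<lambda>y. v1 y * v2 y)"
  unfolding taylor_kernel_def
proof (intro conjI allI)
  show "0 \<le> B1 + B2" using assms by (simp add: taylor_kernel_def)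
  show "continuous_on UNIV (\<lambda>y. \<Sum>i\<le>a. c1 i y * c2 (a - i) y)" for a
    using assms by (auto simp: taylor_kernel_def intro!: continuous_intros)
  fix x y
  have s: "suminf (\<lambda>a. c1 a y * x ^ a) = S1 (y - x)" "suminf (\<lambda>a. c2 a y * x ^ a) = S2 (y - x)"
    using assms by (auto simp: taylor_kernel_def sums_iff)
  have "(\<lambda>a. \<Sum>i\<le>a. (c1 i y * x ^ i) * (c2 (a - i) y * x ^ (a - i))) sums (S1 (y - x) * S2 (y - x))"
    using Cauchy_product_sums[OF taylor_kernel_summable[OF 1, of y x] taylor_kernel_summable[OF 2, of y x]]
    unfolding s .
  also have "(\<lambda>a. \<Sum>i\<le>a. (c1 i y * x ^ i) * (c2 (a - i) y * x ^ (a - i))) =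
      (\<lambda>a. (\<Sum>i\<le>a. c1 i y * c2 (a - i) y) * x ^ a)"
  proof (rule ext, unfold sum_distrib_right, intro sum.cong refl)
    fix a i :: nat assume "i \<in> {..a}"
    then have "x ^ a = x ^ i * x ^ (a - i)" by (simp add: power_add[symmetric])
    then show "c1 i y * x ^ i * (c2 (a - i) y * x ^ (a - i)) = c1 i y * c2 (a - i) y * x ^ a" by simp
  qed
  finally show "(\<lambda>a. (\<Sum>i\<le>a. c1 i y * c2 (a - i) y) * x ^ a) sums (S1 (y - x) * S2 (y - x))" .
next
  fix a y
  have b: "\<bar>c1 i y\<bar> \<le> B1 ^ i / fact i * v1 y" "\<bar>c2 i y\<bar> \<le> B2 ^ i / fact i * v2 y" for i
    using assms by (auto simp: taylor_kernel_def)
  have "\<bar>\<Sum>i\<le>a. c1 i y * c2 (a - i) y\<bar> \<le> (\<Sum>i\<le>a. \<bar>c1 i y * c2 (a - i) y\<bar>)"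
    by (rule sum_abs)
  also have "\<dots> \<le> (\<Sum>i\<le>a. (B1 ^ i / fact i * v1 y) * (B2 ^ (a - i) / fact (a - i) * v2 y))"
    unfolding abs_mult by (intro sum_mono mult_mono b order_trans[OF abs_ge_zero b(1)]) auto
  also have "\<dots> = (\<Sum>i\<le>a. (B1 ^ i / fact i) * (B2 ^ (a - i) / fact (a - i))) * (v1 y * v2 y)"
    unfolding sum_distrib_right by (intro sum.cong refl) (simp only: mult_ac)
  finally show "\<bar>\<Sum>i\<le>a. c1 i y * c2 (a - i) y\<bar> \<le> (B1 + B2) ^ a / fact a * (v1 y * v2 y)"
    unfolding sum_exp_coeffs .
qed

lemma taylor_kernel_one: "taylor_kernel (\<lambda>_. 1) (\<lambda>a y. if a = 0 then 1 else 0) 0 (\<lambda>_. 1)"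
proof -
  have "(\<lambda>a. (if a = 0 then 1 else 0) * x ^ a) sums 1" for x :: real
    using sums_finite[of "{0}" "\<lambda>a. (if a = 0 then 1 else 0) * x ^ a"] by simp
  then show ?thesis by (auto simp: taylor_kernel_def)
qed

text \<open>Powers buy decay of any order, while the type grows only linearly and the coefficients
  keep the factor \<open>1 / fact a\<close>.\<close>

lemma taylor_kernel_power:
  assumes "taylor_kernel S c B v"
  shows "\<exists>c'. taylor_kernel (\<lambda>u. S u ^ M) c' (real M * B) (\<lambda>y. v y ^ M)"
proof (induction M)
  case 0
  show ?case using taylor_kernel_one by auto
next
  case (Suc M)
  then obtain c' where "taylor_kernel (\<lambda>u. S u ^ M) c' (real M * B) (\<lambda>y. v y ^ M)" by auto
  then have k: "taylor_kernel (\<lambda>u. S u * S u ^ M) (\<lambda>a y. \<Sum>i\<le>a. c i y * c' (a - i) y)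
      (B + real M * B) (\<lambda>y. v y * v y ^ M)"
    by (rule taylor_kernel_mult[OF assms])
  have "real (Suc M) * B = B + real M * B" by (simp add: algebra_simps)
  then show ?case unfolding power_Suc using k by (simp only:) (rule exI)
qed

text \<open>Shrinking the width by the factor \<open>A\<close> multiplies the type by
  \<open>A\<close>.\<close>

lemma taylor_kernel_scale:
  assumes "taylor_kernel S c B v" "A \<ge> 0"
  shows "taylor_kernel (\<lambda>u. s * S (A * u)) (\<lambda>a y. s * A ^ a * c a (A * y)) (A * B) (\<lambda>y. \<bar>s\<bar> * v (A * y))"
  unfolding taylor_kernel_def
proof (intro conjI allI)
  show "0 \<le> A * B" using assms by (simp add: taylor_kernel_def)
  have "continuous_on UNIV (c a)" for a using assms by (simp add: taylor_kernel_def)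
  then have "continuous_on UNIV (\<lambda>y. c a (A * y))" for a
    by (rule continuous_on_compose2) (auto intro!: continuous_intros)
  then show "continuous_on UNIV (\<lambda>y. s * A ^ a * c a (A * y))" for a
    by (intro continuous_on_mult continuous_on_const)
  fix x y
  have "(\<lambda>a. c a (A * y) * (A * x) ^ a) sums S (A * y - A * x)"
    using assms by (simp add: taylor_kernel_def)
  from sums_mult[OF this, of s]
  show "(\<lambda>a. s * A ^ a * c a (A * y) * x ^ a) sums (s * S (A * (y - x)))"
    by (simp add: power_mult_distrib algebra_simps)
next
  fix a y
  have "\<bar>c a (A * y)\<bar> \<le> B ^ a / fact a * v (A * y)" using assms by (simp add: taylor_kernel_def)
  then have "\<bar>s\<bar> * A ^ a * \<bar>c a (A * y)\<bar> \<le> \<bar>s\<bar> * A ^ a * (B ^ a / fact a * v (A * y))"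
    using assms by (intro mult_left_mono) auto
  then show "\<bar>s * A ^ a * c a (A * y)\<bar> \<le> (A * B) ^ a / fact a * (\<bar>s\<bar> * v (A * y))"
    using assms by (simp add: abs_mult power_mult_distrib mult_ac)
qed

text \<open>The real part of the exponential series for \<open>cis (v - \<theta>)\<close>. Powers of
  -i are rotations by multiples of a quarter turn, so every derivative of the cosine is again a
  cosine with shifted phase.\<close>

lemma cos_diff_sums:
  fixes v \<theta> :: real
  shows "(\<lambda>a. \<theta> ^ a / fact a * cos (v - real a * (pi / 2))) sums cos (v - \<theta>)"
proof -
  have "(\<lambda>a. cis v * ((- \<i> * of_real \<theta>) ^ a /\<^sub>R fact a)) sums (cis v * exp (- \<i> * of_real \<theta>))"
    by (intro sums_mult exp_converges)
  then have "(\<lambda>a. Re (cis v * ((- \<i> * of_real \<theta>) ^ a /\<^sub>R fact a))) sums Re (cis v * exp (- \<i> * of_real \<theta>))"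
    by (rule sums_Re)
  also have "cis v * exp (- \<i> * of_real \<theta>) = cis (v - \<theta>)"
    using cis_conv_exp[of "- \<theta>"] by (simp add: cis_mult[symmetric] diff_conv_add_uminus del: add_uminus_conv_diff)
  also have "(\<lambda>a. Re (cis v * ((- \<i> * of_real \<theta>) ^ a /\<^sub>R fact a))) =
      (\<lambda>a. \<theta> ^ a / fact a * cos (v - real a * (pi / 2)))"
  proof
    fix a :: nat
    have e: "- \<i> * of_real \<theta> = of_real \<theta> * cis (- (pi / 2))" by (simp add: complex_eq_iff)
    have "(- \<i> * of_real \<theta>) ^ a = of_real (\<theta> ^ a) * cis (- (real a * (pi / 2)))"
      unfolding e power_mult_distrib Complex.DeMoivre by simp
    then have "cis v * ((- \<i> * of_real \<theta>) ^ a /\<^sub>R fact a) = of_real (\<theta> ^ a / fact a) * cis (v - real a * (pi / 2))"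
      by (simp add: cis_mult[symmetric] diff_conv_add_uminus scaleR_conv_of_real field_simps
          del: add_uminus_conv_diff)
    then show "Re (cis v * ((- \<i> * of_real \<theta>) ^ a /\<^sub>R fact a)) = \<theta> ^ a / fact a * cos (v - real a * (pi / 2))"
      by (simp only: times_complex.sel Re_complex_of_real Im_complex_of_real cis.sel mult_zero_left diff_zero)
  qed
  finally show ?thesis by simp
qed

text \<open>The function \<open>sin u / u\<close>, written so that its derivatives and their decay are accessible.\<close>

definition sincf :: "real \<Rightarrow> real" where
  "sincf u = integral {0..1} (\<lambda>t. cos (u * t))"

text \<open>Obtained by integrating the shifted-phase cosine series with angle \<open>x * t\<close>
  term by term.\<close>

definition sincf_coeff :: "nat \<Rightarrow> real \<Rightarrow> real" where
  "sincf_coeff a y = integral {0..1} (\<lambda>t. t ^ a * cos (y * t - real a * (pi / 2))) / fact a"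

lemma sincf_integrand_bound:
  "\<bar>integral {0..1} (\<lambda>t. t ^ a * cos (y * t - real a * (pi / 2)))\<bar> \<le> 1" (is "\<bar>integral _ ?f\<bar> \<le> 1")
proof -
  have "norm (integral {0..1} ?f) \<le> integral {0..1} (\<lambda>t::real. 1::real)"
  proof (rule Henstock_Kurzweil_Integration.integral_norm_bound_integral)
    show "?f integrable_on {0..1}" by (intro integrable_continuous_real continuous_intros)
    fix t :: real assume "t \<in> {0..1}"
    then have "t ^ a \<le> 1" "0 \<le> t ^ a" by (auto intro: power_le_one)
    then show "norm (?f t) \<le> 1" using abs_cos_le_one[of "y * t - real a * (pi / 2)"]
      by (auto simp: abs_mult intro: mult_le_one)
  qed auto
  then show ?thesis by simp
qed

text \<open>Integration by parts: the boundary term is a sine, and the remaining integrand is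
  dominated by the derivative of \<open>t ^ a\<close>, whose integral is at most 1. Hence the bound
  does not depend on \<open>a\<close>.\<close>

lemma sincf_integrand_decay:
  "\<bar>y * integral {0..1} (\<lambda>t. t ^ a * cos (y * t - real a * (pi / 2)))\<bar> \<le> 2"
proof -
  let ?\<phi> = "\<lambda>t. y * t - real a * (pi / 2)"
  let ?f = "\<lambda>t. t ^ a * cos (?\<phi> t)" and ?g = "\<lambda>t. real a * t ^ (a - 1) * sin (?\<phi> t)"
  have int: "?f integrable_on {0..1}" "?g integrable_on {0..1}"
    by (intro integrable_continuous_real continuous_intros)+
  have "((\<lambda>t. ?g t + y * ?f t) has_integral (1 ^ a * sin (?\<phi> 1) - 0 ^ a * sin (?\<phi> 0))) {0..1}"
    by (intro fundamental_theorem_of_calculus)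
      (auto intro!: derivative_eq_intros simp: has_real_derivative_iff_has_vector_derivative[symmetric])
  then have "integral {0..1} (\<lambda>t. ?g t + y * ?f t) = 1 ^ a * sin (?\<phi> 1) - 0 ^ a * sin (?\<phi> 0)"
    by (rule integral_unique)
  moreover have "integral {0..1} (\<lambda>t. ?g t + y * ?f t) = integral {0..1} ?g + y * integral {0..1} ?f"
    using int by (subst integral_add) (auto intro!: integrable_continuous_real continuous_intros)
  \<comment> \<open>For \<open>a = 0\<close> the power \<open>0 ^ a\<close> is 1, but then the phase
    at 0 is 0 and the sine vanishes.\<close>
  moreover have "0 ^ a * sin (?\<phi> 0) = 0" by (cases "a = 0") auto
  ultimately have "integral {0..1} ?g + y * integral {0..1} ?f = sin (?\<phi> 1)"
    by (simp only: power_one mult_1 diff_zero)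
  moreover have "\<bar>integral {0..1} ?g\<bar> \<le> 1"
  proof -
    have I: "((\<lambda>t. real a * t ^ (a - 1)) has_integral (1 ^ a - 0 ^ a)) {0..1}"
      by (intro fundamental_theorem_of_calculus)
        (auto intro!: derivative_eq_intros simp: has_real_derivative_iff_has_vector_derivative[symmetric])
    have "norm (integral {0..1} ?g) \<le> integral {0..1} (\<lambda>t. real a * t ^ (a - 1))"
    proof (rule Henstock_Kurzweil_Integration.integral_norm_bound_integral)
      fix t :: real assume t: "t \<in> {0..1}"
      then have "real a * t ^ (a - 1) * \<bar>sin (?\<phi> t)\<bar> \<le> real a * t ^ (a - 1) * 1"
        by (intro mult_left_mono) auto
      then show "norm (?g t) \<le> real a * t ^ (a - 1)"
        using t by (simp add: abs_mult)
    qed (use int I in auto)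
    also have "\<dots> = 1 ^ a - 0 ^ a" using I by (rule integral_unique)
    also have "\<dots> \<le> 1" by simp
    finally show ?thesis by simp
  qed
  moreover have "\<bar>sin (?\<phi> 1)\<bar> \<le> 1" by simp
  ultimately show ?thesis by linarith
qed

text \<open>Dominated convergence with majorant \<open>exp \<bar>x\<bar>\<close> justifies termwise
  integration. The constant 3 adds the uniform bound 1 and the decay bound 2.\<close>

lemma taylor_kernel_sincf: "taylor_kernel sincf sincf_coeff 1 (\<lambda>y. 3 / (1 + \<bar>y\<bar>))"
  unfolding taylor_kernel_def
proof (intro conjI allI)
  show "continuous_on UNIV (sincf_coeff a)" for a
    unfolding sincf_coeff_def cbox_interval[symmetric]
    by (intro continuous_on_divide integral_continuous_on_param continuous_on_const)
      (auto simp: split_beta intro!: continuous_intros)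
  fix x y :: real
  define f where "f = (\<lambda>n t. \<Sum>a<n. (x * t) ^ a / fact a * cos (y * t - real a * (pi / 2)))"
  have "(\<lambda>n. integral {0..1} (f n)) \<longlonglongrightarrow> integral {0..1} (\<lambda>t. cos ((y - x) * t))"
  proof (rule dominated_convergence(2))
    show "f n integrable_on {0..1}" for n
      unfolding f_def by (intro integrable_continuous_real continuous_intros) auto
    show "(\<lambda>t. exp \<bar>x\<bar>) integrable_on {0..1::real}" by (intro integrable_continuous_real continuous_intros)
    fix t :: real assume t: "t \<in> {0..1}"
    show "(\<lambda>n. f n t) \<longlonglongrightarrow> cos ((y - x) * t)"
      using cos_diff_sums[of "x * t" "y * t"] by (simp add: f_def sums_def algebra_simps)
    fix n
    have "\<bar>f n t\<bar> \<le> (\<Sum>a<n. \<bar>(x * t) ^ a / fact a * cos (y * t - real a * (pi / 2))\<bar>)"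
      unfolding f_def by (rule sum_abs)
    also have "\<dots> \<le> (\<Sum>a<n. \<bar>x\<bar> ^ a / fact a)"
    proof (intro sum_mono)
      fix a
      have "\<bar>x * t\<bar> ^ a \<le> \<bar>x\<bar> ^ a"
        using t by (intro power_mono) (auto simp: abs_mult mult_left_le)
      then have "\<bar>x * t\<bar> ^ a / fact a * \<bar>cos (y * t - real a * (pi / 2))\<bar> \<le> \<bar>x\<bar> ^ a / fact a * 1"
        by (intro mult_mono divide_right_mono) auto
      then show "\<bar>(x * t) ^ a / fact a * cos (y * t - real a * (pi / 2))\<bar> \<le> \<bar>x\<bar> ^ a / fact a"
        by (simp add: abs_mult power_abs)
    qed
    also have "\<dots> \<le> exp \<bar>x\<bar>"
    proof -
      have "suminf (\<lambda>a. \<bar>x\<bar> ^ a / fact a) = exp \<bar>x\<bar>" by (simp add: exp_def divide_inverse mult.commute)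
      then show ?thesis using sum_le_suminf[OF summable_exp_real[of "\<bar>x\<bar>"], of "{..<n}"] by simp
    qed
    finally show "norm (f n t) \<le> exp \<bar>x\<bar>" by simp
  qed
  moreover have "integral {0..1} (f n) = (\<Sum>a<n. sincf_coeff a y * x ^ a)" for n
  proof -
    have "integral {0..1} (f n) =
        (\<Sum>a<n. integral {0..1} (\<lambda>t. x ^ a / fact a * (t ^ a * cos (y * t - real a * (pi / 2)))))"
      unfolding f_def
      by (subst integral_sum) (auto intro!: integrable_continuous_real continuous_intros simp: power_mult_distrib mult_ac)
    also have "\<dots> = (\<Sum>a<n. sincf_coeff a y * x ^ a)"
      unfolding integral_mult_right sincf_coeff_def by (intro sum.cong refl) simp
    finally show ?thesis .
  qed
  ultimately show "(\<lambda>a. sincf_coeff a y * x ^ a) sums sincf (y - x)"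
    by (simp add: sums_def sincf_def)
next
  fix a and y :: real
  let ?I = "integral {0..1} (\<lambda>t. t ^ a * cos (y * t - real a * (pi / 2)))"
  have "\<bar>?I\<bar> * (1 + \<bar>y\<bar>) \<le> 3"
    using sincf_integrand_bound[where a = a and y = y] sincf_integrand_decay[where a = a and y = y]
    by (simp add: abs_mult algebra_simps)
  then have "\<bar>?I\<bar> \<le> 3 / (1 + \<bar>y\<bar>)" by (simp add: pos_le_divide_eq add_pos_nonneg)
  then show "\<bar>sincf_coeff a y\<bar> \<le> 1 ^ a / fact a * (3 / (1 + \<bar>y\<bar>))"
    using divide_right_mono[of "\<bar>?I\<bar>" "3 / (1 + \<bar>y\<bar>)" "fact a"] by (simp add: sincf_coeff_def mult.commute)
qed simp

section \<open>Approximation of point masses\<close>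

lemma integrable_inverse_1_plus_square_UNIV: "integrable lborel (\<lambda>x::real. inverse (1 + x\<^sup>2))"
  using integrable_inverse_1_plus_square by (simp add: set_integrable_def einterval_def)

text \<open>The square of the decay weight of \<open>sincf ^ (D + 1)\<close> at scale
  \<open>A\<close>.\<close>

definition kweight :: "nat \<Rightarrow> real \<Rightarrow> real \<Rightarrow> real" where
  "kweight D A y = (3 / (1 + \<bar>A * y\<bar>)) ^ (2 * (D + 1))"

text \<open>A bound for all absolute moments of \<open>kweight\<close> up to order \<open>D\<close>,
  uniform in the scale \<open>A \<ge> 1\<close>.\<close>

definition kmass :: "nat \<Rightarrow> real" where
  "kmass D = 9 ^ (D + 1) * (\<integral>x. inverse (1 + x\<^sup>2) \<partial>lborel)"

lemma kmass_nonneg: "0 \<le> kmass D"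
  unfolding kmass_def by (intro mult_nonneg_nonneg integral_nonneg_AE) (auto intro!: AE_I2)

text \<open>With \<open>z = 1 + \<bar>A * y\<bar>\<close>, two of the \<open>2 * (D + 1)\<close>
  powers of \<open>z\<close> pay for \<open>1 + y\<^sup>2\<close> and the others for
  \<open>\<bar>y\<bar> ^ d\<close>.\<close>

lemma kweight_bound:
  assumes "1 \<le> A" "d \<le> D"
  shows "\<bar>y\<bar> ^ d * kweight D A y \<le> 9 ^ (D + 1) * inverse (1 + y\<^sup>2)"
proof -
  define z where "z = 1 + \<bar>A * y\<bar>"
  have zy: "1 + \<bar>y\<bar> \<le> z" using assms mult_right_mono[of 1 A "\<bar>y\<bar>"] by (simp add: z_def abs_mult)
  then have z: "1 \<le> z" "\<bar>y\<bar> \<le> z" by auto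
  have "\<bar>y\<bar> ^ d \<le> z ^ d" using z by (intro power_mono) auto
  also have "\<dots> \<le> z ^ (2 * D)" using z assms by (intro power_increasing) auto
  finally have 1: "\<bar>y\<bar> ^ d \<le> z ^ (2 * D)" .
  have "1 + y\<^sup>2 \<le> (1 + \<bar>y\<bar>)\<^sup>2" by (simp add: power2_sum)
  also have "\<dots> \<le> z\<^sup>2" using zy by (intro power_mono) auto
  finally have "\<bar>y\<bar> ^ d * (1 + y\<^sup>2) \<le> z ^ (2 * D) * z\<^sup>2" using 1 z by (intro mult_mono) auto
  also have "\<dots> = z ^ (2 * (D + 1))" by (simp add: power_add[symmetric])
  finally have 2: "\<bar>y\<bar> ^ d * (1 + y\<^sup>2) \<le> z ^ (2 * (D + 1))" .
  have "kweight D A y = 9 ^ (D + 1) / z ^ (2 * (D + 1))"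
    unfolding kweight_def z_def[symmetric] power_divide by (simp only: power_mult) simp
  moreover have "\<bar>y\<bar> ^ d / z ^ (2 * (D + 1)) \<le> inverse (1 + y\<^sup>2)"
  proof -
    have "0 < 1 + y\<^sup>2" "0 < z ^ (2 * (D + 1))" using z by (auto simp: add_pos_nonneg)
    with 2 show ?thesis by (simp only: divide_le_eq pos_le_divide_eq inverse_eq_divide if_True times_divide_eq_left mult_1)
  qed
  then have "9 ^ (D + 1) * (\<bar>y\<bar> ^ d / z ^ (2 * (D + 1))) \<le> 9 ^ (D + 1) * inverse (1 + y\<^sup>2)"
    by (intro mult_left_mono) auto
  ultimately show ?thesis by (simp only: times_divide_eq_right mult.commute)
qed

lemma moment_bound:
  fixes f :: "real \<Rightarrow> real"
  assumes "continuous_on UNIV f" "\<And>y. \<bar>f y\<bar> \<le> K * kweight D A y" "0 \<le> K" "1 \<le> A" "d \<le> D"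
  shows "integrable lborel (\<lambda>y. y ^ d * f y)"
    and "(\<integral>y. \<bar>y ^ d * f y\<bar> \<partial>lborel) \<le> K * kmass D"
proof -
  have b: "\<bar>y ^ d * f y\<bar> \<le> K * (9 ^ (D + 1) * inverse (1 + y\<^sup>2))" for y
  proof -
    have "\<bar>y ^ d * f y\<bar> \<le> \<bar>y\<bar> ^ d * (K * kweight D A y)"
      using assms by (auto simp: abs_mult power_abs intro!: mult_left_mono)
    also have "\<dots> = K * (\<bar>y\<bar> ^ d * kweight D A y)" by simp
    also have "\<dots> \<le> K * (9 ^ (D + 1) * inverse (1 + y\<^sup>2))"
      using assms by (intro mult_left_mono kweight_bound) auto
    finally show ?thesis .
  qed
  have i: "integrable lborel (\<lambda>y. K * (9 ^ (D + 1) * inverse (1 + y\<^sup>2)))"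
    by (intro integrable_mult_right integrable_inverse_1_plus_square_UNIV)
  have m: "(\<lambda>y. y ^ d * f y) \<in> borel_measurable lborel"
    using assms by (auto intro!: borel_measurable_continuous_onI continuous_intros)
  show int: "integrable lborel (\<lambda>y. y ^ d * f y)"
    by (rule Bochner_Integration.integrable_bound[OF i m]) (use b in \<open>auto intro: order_trans[OF _ abs_ge_self]\<close>)
  have "(\<integral>y. \<bar>y ^ d * f y\<bar> \<partial>lborel) \<le> (\<integral>y. K * (9 ^ (D + 1) * inverse (1 + y\<^sup>2)) \<partial>lborel)"
    by (intro integral_mono i b integrable_abs int)
  then show "(\<integral>y. \<bar>y ^ d * f y\<bar> \<partial>lborel) \<le> K * kmass D" by (simp add: kmass_def)
qed

lemma taylor_kernel_coeff_0: "taylor_kernel S c B v \<Longrightarrow> S y = c 0 y"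
proof -
  assume "taylor_kernel S c B v"
  then have "(\<lambda>a. c a y * 0 ^ a) sums S (y - 0)" unfolding taylor_kernel_def by blast
  moreover have "(\<lambda>a. c a y * 0 ^ a) sums c 0 y"
    using sums_finite[of "{0}" "\<lambda>a. c a y * 0 ^ a"] by (simp add: power_0_left)
  ultimately show ?thesis using sums_unique2 by fastforce
qed

text \<open>Sum and integral may be interchanged: by exponential type, the integrals of the absolute
  values are dominated by \<open>K * kmass D\<close> times an exponential series.\<close>

lemma taylor_kernel_moment_sums:
  assumes k: "taylor_kernel F h B v" and v: "\<And>y. v y = K * kweight D A y"
    and "0 \<le> K" "1 \<le> A" "d \<le> D"
  shows "(\<lambda>g. (\<integral>y. y ^ d * h g y \<partial>lborel) * x ^ g) sums (\<integral>y. y ^ d * F (y - x) \<partial>lborel)"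
proof -
  have B: "0 \<le> B" and cont: "continuous_on UNIV (h g)"
    and bd: "\<bar>h g y\<bar> \<le> (B ^ g / fact g * K) * kweight D A y" for g y
    using k v by (auto simp: taylor_kernel_def mult.assoc)
  note mb = moment_bound[OF cont bd _ assms(4,5)]
  have C: "0 \<le> B ^ g / fact g * K" for g using B assms by simp
  have s: "(\<lambda>g. h g y * x ^ g) sums F (y - x)" for y using k by (simp add: taylor_kernel_def)
  have "(\<lambda>g. \<integral>y. y ^ d * h g y * x ^ g \<partial>lborel) sums (\<integral>y. suminf (\<lambda>g. y ^ d * h g y * x ^ g) \<partial>lborel)"
  proof (rule sums_integral)
    show "integrable lborel (\<lambda>y. y ^ d * h g y * x ^ g)" for g
      by (intro integrable_mult_left mb(1) C)
    have "summable (\<lambda>g. norm (y ^ d * h g y * x ^ g))" for y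
      using summable_mult[OF taylor_kernel_summable[OF k, of y x], of "\<bar>y ^ d\<bar>"]
      by (simp add: abs_mult mult_ac)
    then show "AE y in lborel. summable (\<lambda>g. norm (y ^ d * h g y * x ^ g))" by simp
    show "summable (\<lambda>g. \<integral>y. norm (y ^ d * h g y * x ^ g) \<partial>lborel)"
    proof (rule summable_comparison_test')
      show "summable (\<lambda>g. K * kmass D * ((B * \<bar>x\<bar>) ^ g / fact g))"
        by (intro summable_mult summable_exp_real)
      fix g
      have "(\<integral>y. norm (y ^ d * h g y * x ^ g) \<partial>lborel) = (\<integral>y. \<bar>y ^ d * h g y\<bar> \<partial>lborel) * \<bar>x\<bar> ^ g"
        by (simp add: abs_mult power_abs)
      also have "\<dots> \<le> ((B ^ g / fact g * K) * kmass D) * \<bar>x\<bar> ^ g"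
        by (intro mult_right_mono mb(2) C) auto
      also have "\<dots> = K * kmass D * ((B * \<bar>x\<bar>) ^ g / fact g)"
        by (simp add: power_mult_distrib)
      finally show "norm (\<integral>y. norm (y ^ d * h g y * x ^ g) \<partial>lborel) \<le> K * kmass D * ((B * \<bar>x\<bar>) ^ g / fact g)"
        by simp
    qed
  qed
  moreover have "suminf (\<lambda>g. y ^ d * h g y * x ^ g) = y ^ d * F (y - x)" for y
    using sums_unique[OF sums_mult[OF s, of "y ^ d" y]] by (simp add: mult.assoc)
  ultimately show ?thesis by simp
qed

text \<open>On this range the angles stay below \<open>pi / 3\<close>. The bound guarantees that the
  bump has positive mass.\<close>

lemma sincf_ge_half: "\<bar>u\<bar> \<le> 1 \<Longrightarrow> 1 / 2 \<le> sincf u"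
proof -
  assume u: "\<bar>u\<bar> \<le> 1"
  have "integral {0..1} (\<lambda>t::real. 1 / 2 :: real) \<le> integral {0..1} (\<lambda>t. cos (u * t))"
  proof (rule integral_le)
    fix t :: real assume t: "t \<in> {0..1}"
    have "\<bar>u * t\<bar> \<le> 1" using u t by (simp add: abs_mult mult_le_one)
    also have "1 \<le> pi / 3" using pi_gt3 by simp
    finally have "cos (pi / 3) \<le> cos \<bar>u * t\<bar>" by (intro cos_monotone_0_pi_le) auto
    then show "1 / 2 \<le> cos (u * t)" by (simp add: cos_60)
  qed (auto intro!: integrable_continuous_real continuous_intros)
  then show ?thesis by (simp add: sincf_def)
qed

lemma sums_polynomial:
  fixes p :: "nat \<Rightarrow> real"
  shows "(\<lambda>g. (if g \<le> d then p g else 0) * x ^ g) sums (\<Sum>g\<le>d. p g * x ^ g)"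
  using sums_finite[of "{..d}" "\<lambda>g. (if g \<le> d then p g else 0) * x ^ g"] by simp

text \<open>\<open>k A a\<close> are the Taylor coefficients in \<open>x\<close> of a bump function of width \<open>1 / A\<close> translated
  by \<open>x\<close>, so that the moments of its square tend to those of the point mass at \<open>x\<close>.\<close>

theorem point_mass_kernel:
  fixes D :: nat
  obtains k :: "nat \<Rightarrow> nat \<Rightarrow> real \<Rightarrow> real" and B K :: "nat \<Rightarrow> real" where
    "\<And>A. 0 \<le> B A" "\<And>A. 0 \<le> K A"
    "\<And>A a b d. d \<le> D \<Longrightarrow> integrable lborel (\<lambda>y. y ^ d * (k A a y * k A b y))"
    "\<And>A a b d. d \<le> D \<Longrightarrow>
       \<bar>\<integral>y. y ^ d * (k A a y * k A b y) \<partial>lborel\<bar> \<le> K A * (B A ^ a / fact a * (B A ^ b / fact b))"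
    "\<And>A g d. d \<le> D \<Longrightarrow> d < g \<Longrightarrow> (\<Sum>i\<le>g. \<integral>y. y ^ d * (k A i y * k A (g - i) y) \<partial>lborel) = 0"
    "\<And>g d. d \<le> D \<Longrightarrow> (\<lambda>A. \<Sum>i\<le>g. \<integral>y. y ^ d * (k A i y * k A (g - i) y) \<partial>lborel)
       \<longlonglongrightarrow> (if g = d then 1 else 0)"
proof -
  \<comment> \<open>The square of this power decays with exponent \<open>2 * (D + 1)\<close>, fast
    enough for all moments up to order \<open>D\<close>.\<close>
  obtain c where c: "taylor_kernel (\<lambda>u. sincf u ^ (D + 1)) c (real (D + 1) * 1) (\<lambda>y. (3 / (1 + \<bar>y\<bar>)) ^ (D + 1))"
    using taylor_kernel_power[OF taylor_kernel_sincf, of "D + 1"] by blast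
  define f where "f = (\<lambda>u. (sincf u ^ (D + 1))\<^sup>2)"
  define m where "m = (\<lambda>j. \<integral>u. u ^ j * f u \<partial>lborel)"
  have f0: "sincf u ^ (D + 1) = c 0 u" for u using taylor_kernel_coeff_0[OF c] .
  have cont_f: "continuous_on UNIV f"
    unfolding f_def f0 using c by (auto simp: taylor_kernel_def intro!: continuous_intros)
  have bd_f: "\<bar>f u\<bar> \<le> 1 * kweight D 1 u" for u
  proof -
    have "\<bar>c 0 u\<bar> \<le> (real (D + 1) * 1) ^ 0 / fact 0 * (3 / (1 + \<bar>u\<bar>)) ^ (D + 1)"
      using c unfolding taylor_kernel_def by blast
    then have "\<bar>c 0 u\<bar>\<^sup>2 \<le> ((3 / (1 + \<bar>u\<bar>)) ^ (D + 1))\<^sup>2"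
      by (intro power_mono) auto
    moreover have "kweight D 1 u = ((3 / (1 + \<bar>u\<bar>)) ^ (D + 1))\<^sup>2"
      unfolding kweight_def power_mult[symmetric] by (simp only: mult.commute mult_1)
    ultimately show ?thesis unfolding f_def f0 by simp
  qed
  have int_f: "integrable lborel (\<lambda>u. u ^ j * f u)" if "j \<le> D" for j
    using moment_bound(1)[OF cont_f bd_f _ _ that] by simp
  have m0: "0 < m 0"
  proof -
    have "(\<integral>u. (1 / 4) ^ (D + 1) * indicator {0..1::real} u \<partial>lborel) \<le> (\<integral>u. u ^ 0 * f u \<partial>lborel)"
    proof (intro integral_mono int_f)
      fix u :: real
      show "(1 / 4) ^ (D + 1) * indicator {0..1} u \<le> u ^ 0 * f u"
      proof (cases "u \<in> {0..1}")
        case True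
        then have "((1 / 2) ^ (D + 1))\<^sup>2 \<le> (sincf u ^ (D + 1))\<^sup>2"
          by (intro power_mono sincf_ge_half) auto
        also have "((1 / 2) ^ (D + 1))\<^sup>2 = (1 / 4 :: real) ^ (D + 1)"
          by (simp only: power_mult[symmetric] mult.commute[of _ 2]) (simp add: power_mult power_divide)
        finally show ?thesis using True by (simp add: f_def)
      qed (simp add: f_def)
    qed auto
    moreover have "0 < (\<integral>u. (1 / 4) ^ (D + 1) * indicator {0..1::real} u \<partial>lborel :: real)" by simp
    ultimately show ?thesis unfolding m_def by linarith
  qed
  \<comment> \<open>Normalises the squared bump at scale \<open>Suc A\<close> to total mass 1; the
    successor keeps the scale at least 1.\<close>
  define s where "s = (\<lambda>A. sqrt (real (Suc A) / m 0))"
  define k where "k = (\<lambda>A a y. s A * real (Suc A) ^ a * c a (real (Suc A) * y))"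
  define B where "B = (\<lambda>A. real (Suc A) * (real (D + 1) * 1))"
  have s2: "(s A)\<^sup>2 = real (Suc A) / m 0" for A unfolding s_def using m0 by simp
  have kA: "taylor_kernel (\<lambda>u. s A * sincf (real (Suc A) * u) ^ (D + 1)) (k A) (B A)
      (\<lambda>y. \<bar>s A\<bar> * (3 / (1 + \<bar>real (Suc A) * y\<bar>)) ^ (D + 1))" for A
    unfolding k_def B_def by (rule taylor_kernel_scale[OF c]) simp
  have w: "(\<bar>s A\<bar> * (3 / (1 + \<bar>real (Suc A) * y\<bar>)) ^ (D + 1)) * (\<bar>s A\<bar> * (3 / (1 + \<bar>real (Suc A) * y\<bar>)) ^ (D + 1)) =
      (s A)\<^sup>2 * kweight D (real (Suc A)) y" for A y
    unfolding kweight_def mult_2 power_add by (simp add: power2_eq_square mult_ac)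
  have B0: "0 \<le> B A" for A by (simp add: B_def)
  have kcont: "continuous_on UNIV (k A a)"
    and kbd: "\<bar>k A a y\<bar> \<le> B A ^ a / fact a * (\<bar>s A\<bar> * (3 / (1 + \<bar>real (Suc A) * y\<bar>)) ^ (D + 1))" for A a y
    using kA[of A] by (auto simp: taylor_kernel_def)
  have kkbd: "\<bar>k A a y * k A b y\<bar> \<le> (s A)\<^sup>2 * (B A ^ a / fact a * (B A ^ b / fact b)) * kweight D (real (Suc A)) y" for A a b y
  proof -
    have "\<bar>k A a y * k A b y\<bar> \<le>
      (B A ^ a / fact a * (\<bar>s A\<bar> * (3 / (1 + \<bar>real (Suc A) * y\<bar>)) ^ (D + 1))) *
      (B A ^ b / fact b * (\<bar>s A\<bar> * (3 / (1 + \<bar>real (Suc A) * y\<bar>)) ^ (D + 1)))"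
      unfolding abs_mult[of "k A a y"] by (intro mult_mono kbd order_trans[OF abs_ge_zero kbd]) auto
    also have "\<dots> = (B A ^ a / fact a * (B A ^ b / fact b)) *
      ((\<bar>s A\<bar> * (3 / (1 + \<bar>real (Suc A) * y\<bar>)) ^ (D + 1)) * (\<bar>s A\<bar> * (3 / (1 + \<bar>real (Suc A) * y\<bar>)) ^ (D + 1)))"
      by (simp only: mult_ac)
    finally show ?thesis unfolding w by (simp only: mult_ac)
  qed
  have kkcont: "continuous_on UNIV (\<lambda>y. k A a y * k A b y)" for A a b
    by (intro continuous_on_mult kcont)
  have nn: "0 \<le> (s A)\<^sup>2 * (B A ^ a / fact a * (B A ^ b / fact b))" for A a b
    using B0 by simp
  note mb = moment_bound[OF kkcont kkbd nn]
  have int: "integrable lborel (\<lambda>y. y ^ d * (k A a y * k A b y))" if "d \<le> D" for A a b d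
    using mb(1)[OF _ that] by simp
  have bound: "\<bar>\<integral>y. y ^ d * (k A a y * k A b y) \<partial>lborel\<bar> \<le>
      (s A)\<^sup>2 * kmass D * (B A ^ a / fact a * (B A ^ b / fact b))" if "d \<le> D" for A a b d
  proof -
    have "\<bar>\<integral>y. y ^ d * (k A a y * k A b y) \<partial>lborel\<bar> \<le> (\<integral>y. \<bar>y ^ d * (k A a y * k A b y)\<bar> \<partial>lborel)"
      by (rule integral_abs_bound)
    also have "\<dots> \<le> (s A)\<^sup>2 * (B A ^ a / fact a * (B A ^ b / fact b)) * kmass D"
      by (rule mb(2)[OF _ that]) simp
    finally show ?thesis by (simp only: mult_ac)
  qed
  \<comment> \<open>Both sides are the coefficient of \<open>x ^ g\<close> in the moment of order
    \<open>d\<close> of the squared bump centred at \<open>x\<close>. The Cauchy product gives the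
    left side; the substitution \<open>y = x + u / R\<close> and the binomial theorem give the right
    side.\<close>
  have coeff: "(\<Sum>i\<le>g. \<integral>y. y ^ d * (k A i y * k A (g - i) y) \<partial>lborel) =
      (if g \<le> d then real (d choose g) * (1 / real (Suc A)) ^ (d - g) * m (d - g) / m 0 else 0)"
    if d: "d \<le> D" for A g d
  proof -
    define h where "h = (\<lambda>g y. \<Sum>i\<le>g. k A i y * k A (g - i) y)"
    define p where "p = (\<lambda>g. real (d choose g) * (1 / real (Suc A)) ^ (d - g) * m (d - g) / m 0)"
    define R where "R = real (Suc A)"
    have R: "R \<ge> 1" by (simp add: R_def)
    have "(\<lambda>g. (\<integral>y. y ^ d * h g y \<partial>lborel) * x ^ g) sums (\<Sum>g\<le>d. p g * x ^ g)" for x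
    proof -
      have "(\<lambda>g. (\<integral>y. y ^ d * h g y \<partial>lborel) * x ^ g) sums
        (\<integral>y. y ^ d * ((s A * sincf (R * (y - x)) ^ (D + 1)) * (s A * sincf (R * (y - x)) ^ (D + 1))) \<partial>lborel)"
        unfolding h_def R_def
        by (rule taylor_kernel_moment_sums[OF taylor_kernel_mult[OF kA[of A] kA[of A]] w]) (use d in auto)
      also have "(\<lambda>y. y ^ d * ((s A * sincf (R * (y - x)) ^ (D + 1)) * (s A * sincf (R * (y - x)) ^ (D + 1)))) =
          (\<lambda>y. y ^ d * ((s A)\<^sup>2 * f (R * (y - x))))"
        by (simp add: f_def power2_eq_square mult_ac)
      also have "(\<integral>y. y ^ d * ((s A)\<^sup>2 * f (R * (y - x))) \<partial>lborel) =
          \<bar>1 / R\<bar> *\<^sub>R (\<integral>u. (x + 1 / R * u) ^ d * ((s A)\<^sup>2 * f (R * ((x + 1 / R * u) - x))) \<partial>lborel)"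
        by (rule lborel_integral_real_affine) (use R in simp)
      also have "\<dots> = (1 / m 0) * (\<integral>u. (x + 1 / R * u) ^ d * f u \<partial>lborel)"
      proof -
        have "(\<lambda>u. (x + 1 / R * u) ^ d * ((s A)\<^sup>2 * f (R * ((x + 1 / R * u) - x)))) =
            (\<lambda>u. (s A)\<^sup>2 * ((x + 1 / R * u) ^ d * f u))"
          using R by (auto simp: mult_ac)
        then show ?thesis using R by (simp add: s2[of A, folded R_def])
      qed
      also have "(\<lambda>u. (x + 1 / R * u) ^ d * f u) =
          (\<lambda>u. \<Sum>g\<le>d. (real (d choose g) * x ^ g * (1 / R) ^ (d - g)) * (u ^ (d - g) * f u))"
        unfolding binomial_ring sum_distrib_right power_mult_distrib
        by (intro ext sum.cong refl) (simp only: mult_ac)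
      also have "(\<integral>u. (\<Sum>g\<le>d. (real (d choose g) * x ^ g * (1 / R) ^ (d - g)) * (u ^ (d - g) * f u)) \<partial>lborel) =
          (\<Sum>g\<le>d. real (d choose g) * x ^ g * (1 / R) ^ (d - g) * m (d - g))"
        unfolding m_def
        by (subst Bochner_Integration.integral_sum) (use d in \<open>auto intro!: integrable_mult_right int_f\<close>)
      also have "1 / m 0 * \<dots> = (\<Sum>g\<le>d. p g * x ^ g)"
        unfolding sum_distrib_left p_def R_def by (intro sum.cong refl) simp
      finally show ?thesis .
    qed
    then have "(\<integral>y. y ^ d * h g y \<partial>lborel) = (if g \<le> d then p g else 0)"
      by (rule powser_coeffs_unique) (rule sums_polynomial)
    moreover have "(\<integral>y. y ^ d * h g y \<partial>lborel) = (\<Sum>i\<le>g. \<integral>y. y ^ d * (k A i y * k A (g - i) y) \<partial>lborel)"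
      unfolding h_def sum_distrib_left by (rule Bochner_Integration.integral_sum) (rule int[OF d])
    ultimately show ?thesis by (simp add: p_def)
  qed
  show ?thesis
  proof (rule that[of B "\<lambda>A. (s A)\<^sup>2 * kmass D" k])
    fix g d assume d: "d \<le> D"
    \<comment> \<open>Only the exponent 0 survives in the limit; applied to \<open>d - g\<close>
      with \<open>g \<le> d\<close>, this singles out \<open>g = d\<close>.\<close>
    have z: "(\<lambda>A. (1 / real (Suc A)) ^ n) \<longlonglongrightarrow> (if n = 0 then 1 else 0)" for n
    proof (cases "n = 0")
      case False
      have "(\<lambda>A. (1 / real (Suc A)) ^ n) \<longlonglongrightarrow> 0 ^ n"
        by (intro tendsto_power LIMSEQ_Suc[OF lim_1_over_n])
      then show ?thesis using False by (simp add: power_0_left)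
    qed simp
    have "(\<lambda>A. if g \<le> d then real (d choose g) * (1 / real (Suc A)) ^ (d - g) * m (d - g) / m 0 else 0)
      \<longlonglongrightarrow> (if g \<le> d then real (d choose g) * (if d - g = 0 then 1 else 0) * m (d - g) / m 0 else 0)"
    proof (cases "g \<le> d")
      case True
      then show ?thesis using m0 by (simp only: if_True) (intro tendsto_intros z, simp)
    qed simp
    also have "(if g \<le> d then real (d choose g) * (if d - g = 0 then 1 else 0) * m (d - g) / m 0 else 0) =
        (if g = d then 1 else 0)"
      using m0 by auto
    finally show "(\<lambda>A. \<Sum>i\<le>g. \<integral>y. y ^ d * (k A i y * k A (g - i) y) \<partial>lborel) \<longlonglongrightarrow> (if g = d then 1 else 0)"
      unfolding coeff[OF d] .
  qed (use B0 int bound kmass_nonneg in \<open>simp_all add: coeff\<close>)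
qed

section \<open>Nonnegative polynomials\<close>

text \<open>A box rather than a bound on the total degree, so that sums of products over the
  coordinates factor into one-variable sums.\<close>

definition expbox :: "nat \<Rightarrow> ('n::finite \<Rightarrow>\<^sub>0 nat) set" where
  "expbox N = {\<gamma>. \<forall>i. Poly_Mapping.lookup \<gamma> i \<le> N}"

lemma bij_betw_lookup_expbox: "bij_betw Poly_Mapping.lookup (expbox N) (PiE UNIV (\<lambda>_::'n::finite. {..N}))"
proof (rule bij_betw_imageI)
  show "inj_on Poly_Mapping.lookup (expbox N)" by (auto simp: inj_on_def intro: poly_mapping_eqI)
  show "Poly_Mapping.lookup ` expbox N = (PiE UNIV (\<lambda>_::'n. {..N}))"
  proof (intro equalityI subsetI)
    fix f assume "f \<in> PiE UNIV (\<lambda>_::'n. {..N})"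
    then have "Abs_poly_mapping f \<in> expbox N" "f = Poly_Mapping.lookup (Abs_poly_mapping f)"
      by (auto simp: expbox_def)
    then show "f \<in> Poly_Mapping.lookup ` expbox N" by blast
  qed (auto simp: expbox_def)
qed

lemma finite_expbox: "finite (expbox N :: ('n::finite \<Rightarrow>\<^sub>0 nat) set)"
  using bij_betw_finite[OF bij_betw_lookup_expbox[where 'n = 'n, of N]] by (simp add: finite_PiE)

lemma expbox_mono: "M \<le> N \<Longrightarrow> expbox M \<subseteq> expbox N"
  by (auto simp: expbox_def intro: order_trans)

lemma mdeg_expbox: "\<gamma> \<in> expbox N \<Longrightarrow> mdeg (\<gamma> :: 'n::finite \<Rightarrow>\<^sub>0 nat) \<le> N * CARD('n)"
  using sum_bounded_above[of UNIV "Poly_Mapping.lookup \<gamma>" N] by (simp add: expbox_def mdeg_def mult.commute)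

lemma sum_expbox_prod:
  fixes u :: "'n::finite \<Rightarrow> nat \<Rightarrow> 'a::comm_semiring_1"
  shows "(\<Sum>\<gamma>\<in>expbox N. \<Prod>i\<in>UNIV. u i (Poly_Mapping.lookup \<gamma> i)) = (\<Prod>i\<in>UNIV. \<Sum>a\<le>N. u i a)"
  by (simp add: prod_sum_PiE sum.reindex_bij_betw[OF bij_betw_lookup_expbox, symmetric])

lemma sum_expbox_expbox_prod:
  fixes u :: "'n::finite \<Rightarrow> nat \<Rightarrow> nat \<Rightarrow> 'a::comm_semiring_1"
  shows "(\<Sum>\<alpha>\<in>expbox N. \<Sum>\<beta>\<in>expbox N. \<Prod>i\<in>UNIV. u i (Poly_Mapping.lookup \<alpha> i) (Poly_Mapping.lookup \<beta> i)) =
    (\<Prod>i\<in>UNIV. \<Sum>a\<le>N. \<Sum>b\<le>N. u i a b)"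
  unfolding sum_expbox_prod[of "\<lambda>i. u i (Poly_Mapping.lookup \<alpha> i)" N for \<alpha>]
  using sum_expbox_prod[of "\<lambda>i a. \<Sum>b\<le>N. u i a b" N] .

section \<open>Factorial estimates and summability\<close>

lemma summable_div_2:
  fixes f :: "nat \<Rightarrow> real"
  assumes "summable f" "\<And>k. 0 \<le> f k"
  shows "summable (\<lambda>a. f (a div 2))"
proof (rule summableI_nonneg_bounded)
  fix n
  have "(\<Sum>a<n. f (a div 2)) \<le> (\<Sum>a<2 * n. f (a div 2))"
    using assms by (intro sum_mono2) auto
  also have "\<dots> = 2 * (\<Sum>k<n. f k)" by (induction n) auto
  also have "\<dots> \<le> 2 * suminf f" using assms by (intro mult_left_mono sum_le_suminf) auto
  finally show "(\<Sum>a<n. f (a div 2)) \<le> 2 * suminf f" .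
qed (use assms in auto)

text \<open>Summands are merged one at a time, and each binomial coefficient that arises is at most
  a power of 2.\<close>

lemma fact_sum_le:
  assumes "finite F"
  shows "fact (sum a F) \<le> (\<Prod>i\<in>F. (2 ^ card F) ^ a i * (fact (a i) :: real))"
proof -
  have "(fact (sum a F) :: real) \<le> 2 ^ (card F * sum a F) * (\<Prod>i\<in>F. fact (a i))"
    using assms
  proof (induction F rule: finite_induct)
    case (insert j F)
    let ?s = "sum a F"
    have "(fact (a j + ?s) :: real) = real ((a j + ?s) choose a j) * (fact (a j) * fact ?s)"
      by (simp add: binomial_fact)
    also have "\<dots> \<le> 2 ^ (a j + ?s) * (fact (a j) * fact ?s)"
    proof (intro mult_right_mono)
      have "real ((a j + ?s) choose a j) \<le> real (2 ^ (a j + ?s))"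
        by (intro of_nat_mono binomial_le_pow2)
      then show "real ((a j + ?s) choose a j) \<le> 2 ^ (a j + ?s)" by simp
    qed auto
    also have "\<dots> \<le> 2 ^ (a j + ?s) * (fact (a j) * (2 ^ (card F * ?s) * (\<Prod>i\<in>F. fact (a i))))"
      by (intro mult_left_mono insert.IH) auto
    also have "\<dots> = 2 ^ (a j + ?s + card F * ?s) * (fact (a j) * (\<Prod>i\<in>F. fact (a i)))"
      by (simp add: power_add)
    also have "\<dots> \<le> 2 ^ (card (insert j F) * (a j + ?s)) * (fact (a j) * (\<Prod>i\<in>F. fact (a i)))"
      using insert.hyps by (intro mult_right_mono power_increasing) (auto intro!: mult_nonneg_nonneg prod_nonneg)
    finally show ?case using insert.hyps by simp
  qed simp
  also have "\<dots> = (\<Prod>i\<in>F. (2 ^ card F) ^ a i * (fact (a i) :: real))"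
    by (simp add: prod.distrib power_mult power_sum)
  finally show ?thesis .
qed

text \<open>Rounding up in every coordinate separately only increases the half degree. The resulting
  bound is a product over the coordinates, as needed for sums over boxes.\<close>

lemma mweight_le:
  fixes \<gamma> :: "'n::finite \<Rightarrow>\<^sub>0 nat"
  shows "mweight \<gamma> \<le> (\<Prod>i\<in>UNIV. (2 ^ CARD('n)) ^ Poly_Mapping.lookup \<gamma> i *
    fact ((Poly_Mapping.lookup \<gamma> i + 1) div 2))"
proof -
  let ?h = "\<lambda>i. (Poly_Mapping.lookup \<gamma> i + 1) div 2"
  have "mdeg \<gamma> \<le> (\<Sum>i\<in>UNIV. 2 * ?h i)" unfolding mdeg_def by (intro sum_mono) linarith
  then have "mdeg \<gamma> \<le> 2 * sum ?h UNIV" by (simp only: sum_distrib_left)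
  then have "(mdeg \<gamma> + 1) div 2 \<le> sum ?h UNIV" by linarith
  then have "mweight \<gamma> \<le> fact (sum ?h UNIV)" unfolding mweight_def by (rule fact_mono)
  also have "\<dots> \<le> (\<Prod>i\<in>UNIV. (2 ^ CARD('n)) ^ ?h i * fact (?h i))" by (rule fact_sum_le) simp
  also have "\<dots> \<le> (\<Prod>i\<in>UNIV. (2 ^ CARD('n)) ^ Poly_Mapping.lookup \<gamma> i * fact (?h i))"
    by (intro prod_mono conjI mult_right_mono power_increasing) auto
  finally show ?thesis .
qed

lemma mweight_nonneg: "0 \<le> mweight \<gamma>"
  by (simp add: mweight_def)

text \<open>Since a binomial coefficient is at least 1, the factorial of the upper half over
  \<open>fact a\<close> is at most the reciprocal factorial of the lower half. What remains is an
  exponential series with every term doubled.\<close>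

lemma summable_half_fact:
  fixes B :: real
  assumes "0 \<le> B"
  shows "summable (\<lambda>a. B ^ a / fact a * fact ((a + 1) div 2))"
proof (rule summable_comparison_test')
  \<comment> \<open>A base of at least 1 has powers increasing in the exponent, which covers odd
    \<open>a\<close>.\<close>
  define E where "E = max 1 B"
  show "summable (\<lambda>a. E * ((E\<^sup>2) ^ (a div 2) / fact (a div 2)))"
    by (intro summable_mult summable_div_2[of "\<lambda>k. (E\<^sup>2) ^ k / fact k"] summable_exp_real) simp
  fix a :: nat
  define h where "h = (a + 1) div 2"
  have ah: "a = h + a div 2" by (simp add: h_def)
  have "fact h * fact (a div 2) \<le> (fact a :: real)"
  proof -
    have "real (a choose h) = fact a / (fact h * fact (a div 2))"
      using binomial_fact[of h a, where 'a = real] ah by (metis add_diff_cancel_left' le_add1)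
    then have "real (a choose h) * (fact h * fact (a div 2)) = fact a" by simp
    moreover have "1 \<le> real (a choose h)" using ah zero_less_binomial[of h a] by linarith
    moreover have "(0::real) \<le> fact h * fact (a div 2)" by simp
    ultimately show ?thesis by (metis mult_1 mult_right_mono)
  qed
  then have 1: "fact h / fact a \<le> 1 / (fact (a div 2) :: real)" by (simp add: field_simps)
  have "B ^ a \<le> E ^ a" using assms by (intro power_mono) (auto simp: E_def)
  also have "\<dots> \<le> E ^ (1 + 2 * (a div 2))" by (intro power_increasing) (auto simp: E_def)
  also have "\<dots> = E * (E\<^sup>2) ^ (a div 2)" by (simp add: power_mult)
  finally have "B ^ a * (fact h / fact a) \<le> (E * (E\<^sup>2) ^ (a div 2)) * (1 / fact (a div 2))"
    by (intro mult_mono 1) (auto simp: E_def)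
  then show "norm (B ^ a / fact a * fact ((a + 1) div 2)) \<le> E * ((E\<^sup>2) ^ (a div 2) / fact (a div 2))"
    using assms by (simp add: h_def)
qed

text \<open>Both boxes give powers of partial sums of \<open>u\<close>, and these have the same
  limit.\<close>

lemma sum_expbox_diff_tendsto_0:
  fixes u :: "nat \<Rightarrow> real"
  assumes "summable u"
  shows "(\<lambda>N. \<Sum>\<gamma>\<in>expbox (2 * N) - expbox N. \<Prod>i\<in>(UNIV :: 'n::finite set). u (Poly_Mapping.lookup \<gamma> i)) \<longlonglongrightarrow> 0"
proof -
  have "(\<Sum>\<gamma>\<in>expbox (2 * N) - expbox N. \<Prod>i\<in>(UNIV :: 'n set). u (Poly_Mapping.lookup \<gamma> i)) =
      (\<Sum>a\<le>2 * N. u a) ^ CARD('n) - (\<Sum>a\<le>N. u a) ^ CARD('n)" for N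
    using sum_expbox_prod[of "\<lambda>_::'n. u" N] sum_expbox_prod[of "\<lambda>_::'n. u" "2 * N"]
    by (subst sum_diff) (auto simp: finite_expbox expbox_mono)
  moreover have l: "(\<lambda>N. \<Sum>a\<le>N. u a) \<longlonglongrightarrow> suminf u"
    using assms summable_LIMSEQ' by blast
  have "(\<lambda>N. (\<Sum>a\<le>2 * N. u a) ^ CARD('n) - (\<Sum>a\<le>N. u a) ^ CARD('n)) \<longlonglongrightarrow>
      suminf u ^ CARD('n) - suminf u ^ CARD('n)"
    using LIMSEQ_subseq_LIMSEQ[OF l, of "\<lambda>N. 2 * N"]
    by (intro tendsto_diff tendsto_power l) (auto simp: strict_mono_def o_def)
  ultimately show ?thesis by simp
qed

text \<open>The coefficient of degree \<open>g\<close> in one variable when the square of a kernel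
  truncated at degree \<open>N\<close> is multiplied out.\<close>

definition trunc_conv :: "(nat \<Rightarrow> nat \<Rightarrow> real) \<Rightarrow> nat \<Rightarrow> nat \<Rightarrow> real" where
  "trunc_conv m N g = (\<Sum>a\<le>N. \<Sum>b\<le>N. if a + b = g then m a b else 0)"

lemma trunc_conv_eq: "trunc_conv m N g = (\<Sum>a\<in>{a. a \<le> g \<and> a \<le> N \<and> g - a \<le> N}. m a (g - a))"
proof -
  have "(\<Sum>b\<le>N. if a + b = g then m a b else 0) = (if a \<le> g \<and> g - a \<le> N then m a (g - a) else 0)" for a
  proof (cases "a \<le> g")
    case True
    then have "(\<Sum>b\<le>N. if a + b = g then m a b else 0) = (\<Sum>b\<le>N. if b = g - a then m a b else 0)"
      by (intro sum.cong) auto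
    then show ?thesis using True by simp
  qed simp
  then have "trunc_conv m N g = (\<Sum>a\<le>N. if a \<le> g \<and> g - a \<le> N then m a (g - a) else 0)"
    by (simp add: trunc_conv_def)
  also have "\<dots> = (\<Sum>a\<in>{..N} \<inter> {a. a \<le> g \<and> g - a \<le> N}. m a (g - a))"
    by (simp add: sum.inter_restrict)
  also have "{..N} \<inter> {a. a \<le> g \<and> g - a \<le> N} = {a. a \<le> g \<and> a \<le> N \<and> g - a \<le> N}" by auto
  finally show ?thesis .
qed

lemma trunc_conv_low: "g \<le> N \<Longrightarrow> trunc_conv m N g = (\<Sum>a\<le>g. m a (g - a))"
  unfolding trunc_conv_eq by (rule sum.cong) auto

lemma trunc_conv_high: "2 * N < g \<Longrightarrow> trunc_conv m N g = 0"
  unfolding trunc_conv_eq by (rule sum.neutral) auto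

text \<open>Extending the sum to the full antidiagonal makes the bound independent of
  \<open>N\<close>; the binomial theorem then turns \<open>B + B\<close> into the base
  \<open>2 * B\<close>.\<close>

lemma trunc_conv_bound:
  assumes "\<And>a b. \<bar>m a b\<bar> \<le> K * (B ^ a / fact a * (B ^ b / fact b))" "0 \<le> K" "0 \<le> B"
  shows "\<bar>trunc_conv m N g\<bar> \<le> K * ((2 * B) ^ g / fact g)"
proof -
  have "\<bar>trunc_conv m N g\<bar> \<le> (\<Sum>a\<in>{a. a \<le> g \<and> a \<le> N \<and> g - a \<le> N}. \<bar>m a (g - a)\<bar>)"
    unfolding trunc_conv_eq by (rule sum_abs)
  also have "\<dots> \<le> (\<Sum>a\<le>g. \<bar>m a (g - a)\<bar>)" by (intro sum_mono2) auto
  also have "\<dots> \<le> (\<Sum>a\<le>g. K * (B ^ a / fact a * (B ^ (g - a) / fact (g - a))))"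
    by (intro sum_mono assms)
  also have "\<dots> = K * ((2 * B) ^ g / fact g)"
    unfolding sum_distrib_left[symmetric] sum_exp_coeffs by simp
  finally show ?thesis .
qed

text \<open>For \<open>m d a b = \<integral> y\<^sup>d k\<^sub>a(y) k\<^sub>b(y) dy\<close> the value of \<open>gram_poly p m N\<close> at \<open>x\<close> is the integral of \<open>p(y)\<close> times the
  square of the product over \<open>i\<close> of the truncated kernels \<open>\<Sum>\<^bsub>a \<le> N\<^esub> k\<^sub>a(y\<^sub>i) x\<^sub>i\<^sup>a\<close>.\<close>

definition gram_entry :: "'n::finite rpoly \<Rightarrow> (nat \<Rightarrow> nat \<Rightarrow> nat \<Rightarrow> real) \<Rightarrow>
    ('n \<Rightarrow>\<^sub>0 nat) \<Rightarrow> ('n \<Rightarrow>\<^sub>0 nat) \<Rightarrow> real" where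
  "gram_entry p m \<alpha> \<beta> = (\<Sum>\<delta>\<in>Poly_Mapping.keys p. Poly_Mapping.lookup p \<delta> *
     (\<Prod>i\<in>UNIV. m (Poly_Mapping.lookup \<delta> i) (Poly_Mapping.lookup \<alpha> i) (Poly_Mapping.lookup \<beta> i)))"

definition gram_poly :: "'n::finite rpoly \<Rightarrow> (nat \<Rightarrow> nat \<Rightarrow> nat \<Rightarrow> real) \<Rightarrow> nat \<Rightarrow> 'n rpoly" where
  "gram_poly p m N = (\<Sum>\<alpha>\<in>expbox N. \<Sum>\<beta>\<in>expbox N. const_poly (gram_entry p m \<alpha> \<beta>) *
     (Poly_Mapping.single \<alpha> 1 * Poly_Mapping.single \<beta> 1))"

text \<open>The condition \<open>\<alpha> + \<beta> = \<gamma>\<close> is a product of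
  coordinatewise conditions, so the double sum over the box factors.\<close>

lemma lookup_gram_poly:
  "Poly_Mapping.lookup (gram_poly p m N) \<gamma> = (\<Sum>\<delta>\<in>Poly_Mapping.keys p. Poly_Mapping.lookup p \<delta> *
     (\<Prod>i\<in>UNIV. trunc_conv (m (Poly_Mapping.lookup \<delta> i)) N (Poly_Mapping.lookup \<gamma> i)))"
proof -
  let ?l = "Poly_Mapping.lookup"
  have ind: "?l (Poly_Mapping.single (\<alpha> + \<beta>) 1) \<gamma> = (\<Prod>i\<in>UNIV. if ?l \<alpha> i + ?l \<beta> i = ?l \<gamma> i then 1 else (0::real))"
    for \<alpha> \<beta> :: "'a \<Rightarrow>\<^sub>0 nat"
  proof (cases "\<alpha> + \<beta> = \<gamma>")
    case True
    then show ?thesis by (auto simp: lookup_add[symmetric])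
  next
    case False
    then obtain i where "?l \<alpha> i + ?l \<beta> i \<noteq> ?l \<gamma> i"
      by (metis lookup_add poly_mapping_eqI)
    then show ?thesis using False by (auto simp: lookup_single when_def prod_zero_iff)
  qed
  have "?l (gram_poly p m N) \<gamma> = (\<Sum>\<alpha>\<in>expbox N. \<Sum>\<beta>\<in>expbox N. \<Sum>\<delta>\<in>Poly_Mapping.keys p. ?l p \<delta> *
      (\<Prod>i\<in>UNIV. if ?l \<alpha> i + ?l \<beta> i = ?l \<gamma> i then m (?l \<delta> i) (?l \<alpha> i) (?l \<beta> i) else 0))"
    unfolding gram_poly_def lookup_sum lookup_const_poly_mult mult_single mult_1 ind gram_entry_def
      sum_distrib_right mult.assoc prod.distrib[symmetric]
    by (intro sum.cong refl arg_cong2[where f = "(*)"] prod.cong) auto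
  also have "\<dots> = (\<Sum>\<delta>\<in>Poly_Mapping.keys p. ?l p \<delta> * (\<Sum>\<alpha>\<in>expbox N. \<Sum>\<beta>\<in>expbox N.
      (\<Prod>i\<in>UNIV. if ?l \<alpha> i + ?l \<beta> i = ?l \<gamma> i then m (?l \<delta> i) (?l \<alpha> i) (?l \<beta> i) else 0)))"
    by (simp only: sum_distrib_left sum.swap[of _ "expbox N" "Poly_Mapping.keys p"])
  finally show ?thesis
    unfolding trunc_conv_def
      sum_expbox_expbox_prod[of "\<lambda>i a b. if a + b = ?l \<gamma> i then m (?l \<delta> i) a b else 0" for \<delta>] .
qed

text \<open>The Gram matrix of \<open>gram_poly\<close> is positive semidefinite because \<open>p\<close> is a nonnegative density.\<close>

lemma is_sos_gram_poly:
  fixes p :: "'n::finite rpoly" and k :: "nat \<Rightarrow> real \<Rightarrow> real"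
  assumes nonneg: "\<And>x. 0 \<le> eval_poly p x"
    and D: "\<And>\<delta> i. \<delta> \<in> Poly_Mapping.keys p \<Longrightarrow> Poly_Mapping.lookup \<delta> i \<le> D"
    and int: "\<And>a b d. d \<le> D \<Longrightarrow> integrable lborel (\<lambda>y. y ^ d * (k a y * k b y))"
  defines "m \<equiv> \<lambda>d a b. \<integral>y. y ^ d * (k a y * k b y) \<partial>lborel"
  shows "is_sos (gram_poly p m N)"
proof -
  let ?l = "Poly_Mapping.lookup"
  interpret product_sigma_finite "\<lambda>_::'n. lborel :: real measure" ..
  let ?P = "Pi\<^sub>M UNIV (\<lambda>_::'n. lborel :: real measure)"
  \<comment> \<open>A product of one-variable functions: by Fubini its integral is the product of
    moments occurring in \<open>gram_entry\<close>.\<close>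
  define G where "G = (\<lambda>(\<alpha> :: 'n \<Rightarrow>\<^sub>0 nat) (\<beta> :: 'n \<Rightarrow>\<^sub>0 nat) (\<delta> :: 'n \<Rightarrow>\<^sub>0 nat) y.
    \<Prod>i\<in>UNIV. (y i ^ ?l \<delta> i * (k (?l \<alpha> i) (y i) * k (?l \<beta> i) (y i))))"
  have Gint: "integrable ?P (G \<alpha> \<beta> \<delta>)" if "\<delta> \<in> Poly_Mapping.keys p" for \<alpha> \<beta> \<delta>
    unfolding G_def by (intro product_integrable_prod int D that) simp
  have Geq: "(\<integral>y. G \<alpha> \<beta> \<delta> y \<partial>?P) = (\<Prod>i\<in>UNIV. m (?l \<delta> i) (?l \<alpha> i) (?l \<beta> i))"
    if "\<delta> \<in> Poly_Mapping.keys p" for \<alpha> \<beta> \<delta>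
    unfolding G_def m_def by (intro product_integral_prod int D that) simp
  have entry: "gram_entry p m \<alpha> \<beta> = (\<integral>y. (\<Sum>\<delta>\<in>Poly_Mapping.keys p. ?l p \<delta> * G \<alpha> \<beta> \<delta> y) \<partial>?P)"
    and entry_int: "integrable ?P (\<lambda>y. \<Sum>\<delta>\<in>Poly_Mapping.keys p. ?l p \<delta> * G \<alpha> \<beta> \<delta> y)" for \<alpha> \<beta>
    unfolding gram_entry_def
    by (subst Bochner_Integration.integral_sum) (auto intro!: Gint integrable_mult_right sum.cong simp: Geq)
  \<comment> \<open>Under the integral, the quadratic form is the value of \<open>p\<close> times a
    square.\<close>
  have pt: "(\<Sum>\<alpha>\<in>expbox N. \<Sum>\<beta>\<in>expbox N. v \<alpha> * v \<beta> * (\<Sum>\<delta>\<in>Poly_Mapping.keys p. ?l p \<delta> * G \<alpha> \<beta> \<delta> y)) =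
      eval_poly p (\<chi> i. y i) * (\<Sum>\<alpha>\<in>expbox N. v \<alpha> * (\<Prod>i\<in>UNIV. k (?l \<alpha> i) (y i)))\<^sup>2" for v y
  proof -
    have e: "(\<Sum>\<delta>\<in>Poly_Mapping.keys p. ?l p \<delta> * G \<alpha> \<beta> \<delta> y) =
      eval_poly p (\<chi> i. y i) * ((\<Prod>i\<in>UNIV. k (?l \<alpha> i) (y i)) * (\<Prod>i\<in>UNIV. k (?l \<beta> i) (y i)))" for \<alpha> \<beta>
      unfolding eval_poly_def G_def prod.distrib sum_distrib_right by (simp add: mult.assoc)
    show ?thesis
      unfolding e power2_eq_square sum_product by (simp add: sum_distrib_left mult_ac)
  qed
  show ?thesis
    unfolding gram_poly_def
  proof (rule is_sos_gram[OF finite_expbox])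
    show "gram_entry p m \<alpha> \<beta> = gram_entry p m \<beta> \<alpha>" for \<alpha> \<beta>
    proof -
      have "m d a b = m d b a" for d a b
        unfolding m_def by (simp add: mult.commute)
      then show ?thesis
        unfolding gram_entry_def by (intro sum.cong refl arg_cong2[where f = "(*)"] prod.cong)
    qed
    fix v :: "('n \<Rightarrow>\<^sub>0 nat) \<Rightarrow> real"
    have "(\<Sum>\<alpha>\<in>expbox N. \<Sum>\<beta>\<in>expbox N. v \<alpha> * v \<beta> * gram_entry p m \<alpha> \<beta>) =
      (\<integral>y. (\<Sum>\<alpha>\<in>expbox N. \<Sum>\<beta>\<in>expbox N. v \<alpha> * v \<beta> * (\<Sum>\<delta>\<in>Poly_Mapping.keys p. ?l p \<delta> * G \<alpha> \<beta> \<delta> y)) \<partial>?P)"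
      unfolding entry
      by (subst Bochner_Integration.integral_sum, intro Bochner_Integration.integrable_sum integrable_mult_right entry_int,
        subst Bochner_Integration.integral_sum, intro integrable_mult_right entry_int) simp
    also have "\<dots> \<ge> 0"
      unfolding pt by (intro integral_nonneg_AE AE_I2 mult_nonneg_nonneg nonneg) auto
    finally show "0 \<le> (\<Sum>\<alpha>\<in>expbox N. \<Sum>\<beta>\<in>expbox N. v \<alpha> * v \<beta> * gram_entry p m \<alpha> \<beta>)" .
  qed
qed

lemma prod_indicator_exponent:
  "(\<Prod>i\<in>(UNIV :: 'n::finite set). if Poly_Mapping.lookup \<gamma> i = Poly_Mapping.lookup \<delta> i then 1 else 0) =
    (if \<gamma> = \<delta> then 1 else (0 :: real))"
proof (cases "\<gamma> = \<delta>")
  case False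
  then obtain i where "Poly_Mapping.lookup \<gamma> i \<noteq> Poly_Mapping.lookup \<delta> i" by (metis poly_mapping_eqI)
  then show ?thesis using False by (auto simp: prod_zero_iff)
qed simp

text \<open>Half of \<epsilon> pays for the change of the low coefficients under convolution, made
  small by the scale \<open>A\<close>. The other half pays for the high terms left by truncation,
  made small by the order \<open>N\<close>.\<close>

theorem nonneg_plus_theta_is_sos:
  fixes p :: "'n::finite rpoly"
  assumes nonneg: "\<And>x. 0 \<le> eval_poly p x" and \<epsilon>: "0 < \<epsilon>"
  shows "\<exists>r\<^sub>0. \<forall>r\<ge>r\<^sub>0. is_sos (p + const_poly \<epsilon> * theta r)"
proof -
  let ?l = "Poly_Mapping.lookup"
  define D where "D = (\<Sum>\<delta>\<in>Poly_Mapping.keys p. mdeg \<delta>)"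
  have D: "?l \<delta> i \<le> D" if "\<delta> \<in> Poly_Mapping.keys p" for \<delta> i
  proof -
    have "?l \<delta> i \<le> mdeg \<delta>" unfolding mdeg_def by (intro member_le_sum) auto
    also have "\<dots> \<le> D" unfolding D_def using that by (intro member_le_sum) auto
    finally show ?thesis .
  qed
  obtain k B K where B: "\<And>A. 0 \<le> (B :: nat \<Rightarrow> real) A" and K: "\<And>A. 0 \<le> (K :: nat \<Rightarrow> real) A"
    and int: "\<And>A a b d. d \<le> D \<Longrightarrow> integrable lborel (\<lambda>y. y ^ d * (k A a y * k A b y))"
    and bd: "\<And>A a b d. d \<le> D \<Longrightarrow>
       \<bar>\<integral>y. y ^ d * (k A a y * k A b y) \<partial>lborel\<bar> \<le> K A * (B A ^ a / fact a * (B A ^ b / fact b))"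
    and van: "\<And>A g d. d \<le> D \<Longrightarrow> d < g \<Longrightarrow> (\<Sum>i\<le>g. \<integral>y. y ^ d * (k A i y * k A (g - i) y) \<partial>lborel) = 0"
    and lim: "\<And>g d. d \<le> D \<Longrightarrow> (\<lambda>A. \<Sum>i\<le>g. \<integral>y. y ^ d * (k A i y * k A (g - i) y) \<partial>lborel)
       \<longlonglongrightarrow> (if g = d then 1 else 0)"
    by (rule point_mass_kernel[of D]) (rule that, assumption+)
  define m where "m = (\<lambda>A d a b. \<integral>y. y ^ d * (k A a y * k A b y) \<partial>lborel)"
  have mbd: "\<bar>m A d a b\<bar> \<le> K A * (B A ^ a / fact a * (B A ^ b / fact b))" if "d \<le> D" for A d a b
    unfolding m_def by (rule bd[OF that])
  \<comment> \<open>The coefficients of the convolution before truncation.\<close>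
  define c where "c = (\<lambda>A \<gamma>. \<Sum>\<delta>\<in>Poly_Mapping.keys p. ?l p \<delta> *
     (\<Prod>i\<in>UNIV. \<Sum>a\<le>?l \<gamma> i. m A (?l \<delta> i) a (?l \<gamma> i - a)))"
  define N\<^sub>0 :: real where "N\<^sub>0 = fact CARD('n)"
  have N0: "0 < N\<^sub>0" by (simp add: N\<^sub>0_def)
  have "(\<lambda>A. N\<^sub>0 * (\<Sum>\<gamma>\<in>expbox D. \<bar>?l p \<gamma> - c A \<gamma>\<bar> * mweight \<gamma>)) \<longlonglongrightarrow>
    N\<^sub>0 * (\<Sum>\<gamma>\<in>expbox D. \<bar>?l p \<gamma> - (\<Sum>\<delta>\<in>Poly_Mapping.keys p. ?l p \<delta> *
      (\<Prod>i\<in>UNIV. if ?l \<gamma> i = ?l \<delta> i then 1 else 0))\<bar> * mweight \<gamma>)"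
    unfolding c_def m_def by (intro tendsto_intros lim D)
  moreover have "(\<Sum>\<delta>\<in>Poly_Mapping.keys p. ?l p \<delta> * (\<Prod>i\<in>UNIV. if ?l \<gamma> i = ?l \<delta> i then 1 else 0)) = ?l p \<gamma>" for \<gamma>
    unfolding prod_indicator_exponent by (simp add: in_keys_iff if_distrib cong: if_cong)
  ultimately have "(\<lambda>A. N\<^sub>0 * (\<Sum>\<gamma>\<in>expbox D. \<bar>?l p \<gamma> - c A \<gamma>\<bar> * mweight \<gamma>)) \<longlonglongrightarrow> 0" by simp
  then have "\<forall>\<^sub>F A in sequentially. N\<^sub>0 * (\<Sum>\<gamma>\<in>expbox D. \<bar>?l p \<gamma> - c A \<gamma>\<bar> * mweight \<gamma>) < \<epsilon> / 2"
    by (rule order_tendstoD) (use \<epsilon> in simp)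
  then obtain A where A: "N\<^sub>0 * (\<Sum>\<gamma>\<in>expbox D. \<bar>?l p \<gamma> - c A \<gamma>\<bar> * mweight \<gamma>) < \<epsilon> / 2"
    by (auto simp: eventually_sequentially)
  define P where "P = (\<Sum>\<delta>\<in>Poly_Mapping.keys p. \<bar>?l p \<delta>\<bar>)"
  define C :: real where "C = 2 ^ CARD('n)"
  \<comment> \<open>One coordinate's share of the bound: the estimate for \<open>trunc_conv\<close>
    times the factor from \<open>mweight_le\<close>.\<close>
  define u where "u = (\<lambda>a. K A * ((2 * B A) ^ a / fact a) * (C ^ a * fact ((a + 1) div 2)))"
  have "summable (\<lambda>a. K A * ((2 * B A * C) ^ a / fact a * fact ((a + 1) div 2)))"
    using B[of A] by (intro summable_mult summable_half_fact) (simp add: C_def)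
  then have "summable u" by (simp add: u_def power_mult_distrib mult_ac)
  from tendsto_mult_left[OF sum_expbox_diff_tendsto_0[OF this, where 'n = 'n], of "N\<^sub>0 * P"]
  have "(\<lambda>N. N\<^sub>0 * P * (\<Sum>\<gamma>\<in>expbox (2 * N) - expbox N. \<Prod>i\<in>(UNIV :: 'n set). u (?l \<gamma> i))) \<longlonglongrightarrow> 0" by simp
  then have "\<forall>\<^sub>F N in sequentially. N\<^sub>0 * P * (\<Sum>\<gamma>\<in>expbox (2 * N) - expbox N. \<Prod>i\<in>(UNIV :: 'n set). u (?l \<gamma> i)) < \<epsilon> / 2"
    by (rule order_tendstoD) (use \<epsilon> in simp)
  then have "\<forall>\<^sub>F N in sequentially. D \<le> N \<and>
      N\<^sub>0 * P * (\<Sum>\<gamma>\<in>expbox (2 * N) - expbox N. \<Prod>i\<in>(UNIV :: 'n set). u (?l \<gamma> i)) < \<epsilon> / 2"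
    by (intro eventually_conj eventually_ge_at_top)
  \<comment> \<open>The order \<open>N\<close> is chosen after \<open>A\<close>, because
    \<open>u\<close> involves \<open>K A\<close> and \<open>B A\<close>.\<close>
  then obtain N where N: "D \<le> N"
      "N\<^sub>0 * P * (\<Sum>\<gamma>\<in>expbox (2 * N) - expbox N. \<Prod>i\<in>(UNIV :: 'n set). u (?l \<gamma> i)) < \<epsilon> / 2"
    by (auto simp: eventually_sequentially)
  define q where "q = gram_poly p (m A) N"
  have q: "is_sos q"
    unfolding q_def m_def by (rule is_sos_gram_poly[OF nonneg D int])
  have lq: "?l q \<gamma> = (\<Sum>\<delta>\<in>Poly_Mapping.keys p. ?l p \<delta> *
     (\<Prod>i\<in>UNIV. trunc_conv (m A (?l \<delta> i)) N (?l \<gamma> i)))" for \<gamma>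
    unfolding q_def by (rule lookup_gram_poly)
  have pD: "?l p \<gamma> = 0" if "\<gamma> \<notin> expbox D" for \<gamma>
    using D that by (auto simp: expbox_def in_keys_iff)
  have low: "?l q \<gamma> = c A \<gamma>" if "\<gamma> \<in> expbox N" for \<gamma>
    unfolding lq c_def using that by (simp add: trunc_conv_low expbox_def)
  \<comment> \<open>Convolution does not raise the degree in any variable: the moment sums vanish
    beyond the order of the moment.\<close>
  have mid: "c A \<gamma> = 0" if \<gamma>: "\<gamma> \<notin> expbox D" for \<gamma>
  proof -
    obtain i where i: "D < ?l \<gamma> i" using \<gamma> by (auto simp: expbox_def not_le)
    have "(\<Sum>a\<le>?l \<gamma> i. m A (?l \<delta> i) a (?l \<gamma> i - a)) = 0" if "\<delta> \<in> Poly_Mapping.keys p" for \<delta>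
      unfolding m_def using van[of "?l \<delta> i" "?l \<gamma> i" A] D[OF that, of i] i by simp
    then have "(\<Prod>i\<in>UNIV. \<Sum>a\<le>?l \<gamma> i. m A (?l \<delta> i) a (?l \<gamma> i - a)) = 0" if "\<delta> \<in> Poly_Mapping.keys p" for \<delta>
      using that by (intro prod_zero) auto
    then show ?thesis unfolding c_def by (intro sum.neutral ballI) simp
  qed
  have high: "\<bar>?l q \<gamma>\<bar> * mweight \<gamma> \<le> P * (\<Prod>i\<in>UNIV. u (?l \<gamma> i))" for \<gamma>
  proof -
    have "\<bar>?l q \<gamma>\<bar> \<le> (\<Sum>\<delta>\<in>Poly_Mapping.keys p. \<bar>?l p \<delta>\<bar> *
        (\<Prod>i\<in>UNIV. K A * ((2 * B A) ^ ?l \<gamma> i / fact (?l \<gamma> i))))"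
      unfolding lq
    proof (rule order_trans[OF sum_abs sum_mono])
      fix \<delta> assume \<delta>: "\<delta> \<in> Poly_Mapping.keys p"
      show "\<bar>?l p \<delta> * (\<Prod>i\<in>UNIV. trunc_conv (m A (?l \<delta> i)) N (?l \<gamma> i))\<bar> \<le>
          \<bar>?l p \<delta>\<bar> * (\<Prod>i\<in>UNIV. K A * ((2 * B A) ^ ?l \<gamma> i / fact (?l \<gamma> i)))"
        unfolding abs_mult abs_prod
        by (intro mult_left_mono prod_mono conjI trunc_conv_bound mbd D \<delta> K B) auto
    qed
    also have "\<dots> = P * (\<Prod>i\<in>UNIV. K A * ((2 * B A) ^ ?l \<gamma> i / fact (?l \<gamma> i)))"
      by (simp add: P_def sum_distrib_right)
    finally have "\<bar>?l q \<gamma>\<bar> * mweight \<gamma> \<le>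
      (P * (\<Prod>i\<in>UNIV. K A * ((2 * B A) ^ ?l \<gamma> i / fact (?l \<gamma> i)))) *
      (\<Prod>i\<in>UNIV. C ^ ?l \<gamma> i * fact ((?l \<gamma> i + 1) div 2))"
      unfolding C_def using K[of A] B[of A]
      by (intro mult_mono mweight_le mweight_nonneg) (auto simp: P_def intro!: mult_nonneg_nonneg prod_nonneg sum_nonneg)
    also have "\<dots> = P * (\<Prod>i\<in>UNIV. u (?l \<gamma> i))"
      by (simp only: u_def prod.distrib mult.assoc)
    finally show ?thesis .
  qed
  have keys: "Poly_Mapping.keys (p - q) \<subseteq> expbox (2 * N)"
  proof (rule subsetI, rule ccontr)
    fix \<gamma> assume \<gamma>: "\<gamma> \<in> Poly_Mapping.keys (p - q)" "\<gamma> \<notin> expbox (2 * N)"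
    then obtain i where i: "2 * N < ?l \<gamma> i" by (auto simp: expbox_def not_le)
    have "(\<Prod>i\<in>UNIV. trunc_conv (m A (?l \<delta> i)) N (?l \<gamma> i)) = 0" for \<delta>
      by (rule prod_zero) (use trunc_conv_high[OF i] in auto)
    then have "?l q \<gamma> = 0" unfolding lq by (intro sum.neutral ballI) simp
    moreover have "?l p \<gamma> = 0" using pD \<gamma>(2) N(1) expbox_mono[of D "2 * N"] by auto
    ultimately show False using \<gamma>(1) by (simp add: in_keys_iff lookup_minus)
  qed
  \<comment> \<open>Inside the box of size \<open>N\<close> truncation is not felt, and the error
    lives in the box of size \<open>D\<close>. Outside, \<open>p\<close> vanishes and only the
    truncation terms of \<open>q\<close> count.\<close>
  have "(\<Sum>\<gamma>\<in>expbox (2 * N). \<bar>?l (p - q) \<gamma>\<bar> * mweight \<gamma>) =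
      (\<Sum>\<gamma>\<in>expbox (2 * N) - expbox N. \<bar>?l (p - q) \<gamma>\<bar> * mweight \<gamma>) + (\<Sum>\<gamma>\<in>expbox N. \<bar>?l (p - q) \<gamma>\<bar> * mweight \<gamma>)"
    by (rule sum.subset_diff) (auto simp: finite_expbox expbox_mono)
  also have "(\<Sum>\<gamma>\<in>expbox N. \<bar>?l (p - q) \<gamma>\<bar> * mweight \<gamma>) = (\<Sum>\<gamma>\<in>expbox D. \<bar>?l p \<gamma> - c A \<gamma>\<bar> * mweight \<gamma>)"
  proof -
    have "(\<Sum>\<gamma>\<in>expbox N. \<bar>?l (p - q) \<gamma>\<bar> * mweight \<gamma>) = (\<Sum>\<gamma>\<in>expbox N. \<bar>?l p \<gamma> - c A \<gamma>\<bar> * mweight \<gamma>)"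
      by (simp add: lookup_minus low)
    also have "\<dots> = (\<Sum>\<gamma>\<in>expbox D. \<bar>?l p \<gamma> - c A \<gamma>\<bar> * mweight \<gamma>)"
      by (rule sum.mono_neutral_right) (auto simp: finite_expbox pD mid intro!: subsetD[OF expbox_mono[OF N(1)]])
    finally show ?thesis .
  qed
  also have "(\<Sum>\<gamma>\<in>expbox (2 * N) - expbox N. \<bar>?l (p - q) \<gamma>\<bar> * mweight \<gamma>) \<le>
      (\<Sum>\<gamma>\<in>expbox (2 * N) - expbox N. P * (\<Prod>i\<in>(UNIV :: 'n set). u (?l \<gamma> i)))"
  proof (rule sum_mono)
    fix \<gamma> :: "'n \<Rightarrow>\<^sub>0 nat" assume "\<gamma> \<in> expbox (2 * N) - expbox N"
    then have "?l p \<gamma> = 0" using pD expbox_mono[OF N(1)] by blast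
    then show "\<bar>?l (p - q) \<gamma>\<bar> * mweight \<gamma> \<le> P * (\<Prod>i\<in>UNIV. u (?l \<gamma> i))"
      using high[of \<gamma>] by (simp add: lookup_minus)
  qed
  finally have "N\<^sub>0 * (\<Sum>\<gamma>\<in>expbox (2 * N). \<bar>?l (p - q) \<gamma>\<bar> * mweight \<gamma>) \<le>
      N\<^sub>0 * ((\<Sum>\<gamma>\<in>expbox (2 * N) - expbox N. P * (\<Prod>i\<in>(UNIV :: 'n set). u (?l \<gamma> i))) +
       (\<Sum>\<gamma>\<in>expbox D. \<bar>?l p \<gamma> - c A \<gamma>\<bar> * mweight \<gamma>))"
    using N0 by (intro mult_left_mono) auto
  also have "\<dots> \<le> \<epsilon>"
    using A N(2) by (simp add: distrib_left sum_distrib_left[symmetric] mult.assoc)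
  finally have tot: "N\<^sub>0 * (\<Sum>\<gamma>\<in>expbox (2 * N). \<bar>?l (p - q) \<gamma>\<bar> * mweight \<gamma>) \<le> \<epsilon>" .
  show ?thesis
  proof (intro exI allI impI)
    \<comment> \<open>Exponents in the box of size \<open>2 * N\<close> have degree at most
      \<open>2 * N * CARD('n)\<close>, so this \<open>r\<close> is large enough.\<close>
    fix r assume r: "N * CARD('n) \<le> r"
    have "is_sos (const_poly \<epsilon> * theta r + (p - q))"
    proof (rule is_sos_theta_plus_poly[OF finite_expbox keys])
      show "mdeg \<gamma> \<le> 2 * r" if "\<gamma> \<in> expbox (2 * N)" for \<gamma> :: "'n \<Rightarrow>\<^sub>0 nat"
        using mdeg_expbox[OF that] r by linarith
    qed (use tot in \<open>simp add: N\<^sub>0_def\<close>)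
    from is_sos_add[OF this q] show "is_sos (p + const_poly \<epsilon> * theta r)"
      by (simp add: algebra_simps)
  qed
qed

section \<open>Nonnegativity on a variety\<close>

definition monom_eval :: "('n::finite \<Rightarrow>\<^sub>0 nat) \<Rightarrow> real ^ 'n \<Rightarrow> real" where
  "monom_eval \<alpha> x = (\<Prod>i\<in>UNIV. (x $ i) ^ Poly_Mapping.lookup \<alpha> i)"

lemma eval_poly_superset:
  assumes "finite S" "Poly_Mapping.keys p \<subseteq> S"
  shows "eval_poly p x = (\<Sum>\<alpha>\<in>S. Poly_Mapping.lookup p \<alpha> * monom_eval \<alpha> x)"
  unfolding eval_poly_def monom_eval_def
  by (rule sum.mono_neutral_left) (use assms in \<open>auto simp: in_keys_iff\<close>)

lemma eval_poly_add: "eval_poly (p + q) x = eval_poly p x + eval_poly q x"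
proof -
  let ?S = "Poly_Mapping.keys p \<union> Poly_Mapping.keys q"
  have "Poly_Mapping.keys (p + q) \<subseteq> ?S" by (rule keys_add)
  then show ?thesis
    by (simp add: eval_poly_superset[of ?S] lookup_add distrib_right sum.distrib)
qed

lemma eval_poly_0 [simp]: "eval_poly 0 x = 0"
  by (simp add: eval_poly_def)

lemma eval_poly_sum: "eval_poly (sum f A) x = (\<Sum>i\<in>A. eval_poly (f i) x)"
  by (induction A rule: infinite_finite_induct) (auto simp: eval_poly_add)

lemma eval_poly_single: "eval_poly (Poly_Mapping.single \<alpha> c) x = c * monom_eval \<alpha> x"
  by (simp add: eval_poly_superset[of "{\<alpha>}"])

lemma monom_eval_add: "monom_eval (\<alpha> + \<beta>) x = monom_eval \<alpha> x * monom_eval \<beta> x"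
  by (simp add: monom_eval_def lookup_add power_add prod.distrib)

lemma eval_poly_mult: "eval_poly (p * q) x = eval_poly p x * eval_poly q x"
proof -
  let ?s = "\<lambda>p. \<Sum>\<gamma>\<in>Poly_Mapping.keys p. Poly_Mapping.single \<gamma> (Poly_Mapping.lookup p \<gamma>)"
  have "eval_poly (?s p * ?s q) x = eval_poly (?s p) x * eval_poly (?s q) x"
    by (simp only: sum_product eval_poly_sum mult_single eval_poly_single monom_eval_add mult_ac)
  then show ?thesis
    using poly_eq_sum_single[of "Poly_Mapping.keys p" p] poly_eq_sum_single[of "Poly_Mapping.keys q" q] by simp
qed

lemma eval_poly_const [simp]: "eval_poly (const_poly c) x = c"
  by (simp add: const_poly_def eval_poly_single monom_eval_def)

lemma eval_poly_power: "eval_poly (p ^ k) x = eval_poly p x ^ k"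
  by (induction k) (simp_all add: eval_poly_mult eval_poly_const[of 1, simplified])

lemma eval_poly_var [simp]: "eval_poly (var_poly i) x = x $ i"
  by (simp add: var_poly_def eval_poly_single monom_eval_def lookup_single when_def if_distrib[of "(^) _"] cong: if_cong)

lemma is_sos_eval_nonneg: "is_sos p \<Longrightarrow> 0 \<le> eval_poly p x"
  by (auto simp: is_sos_def eval_poly_sum eval_poly_power intro!: sum_nonneg)

lemma continuous_on_eval_poly: "continuous_on S (eval_poly p)"
  unfolding eval_poly_def by (intro continuous_intros)

section \<open>Coercivity of theta and penalties on compact sets\<close>

definition exp_trunc :: "nat \<Rightarrow> real \<Rightarrow> real" where
  "exp_trunc k t = (\<Sum>j\<le>k. t ^ j / fact j)"

lemma eval_poly_theta: "eval_poly (theta k) x = (\<Sum>i\<in>UNIV. exp_trunc k ((x $ i)\<^sup>2))"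
  unfolding theta_eq power_sum_def exp_trunc_def
  by (simp add: eval_poly_sum eval_poly_mult eval_poly_power sum_distrib_left sum.swap[of _ UNIV] power_mult)

lemma exp_trunc_ge_1: "0 \<le> t \<Longrightarrow> 1 \<le> exp_trunc k t"
  unfolding exp_trunc_def by (subst sum.atMost_shift) (auto intro!: sum_nonneg)

lemma exp_trunc_mono: "0 \<le> s \<Longrightarrow> s \<le> t \<Longrightarrow> exp_trunc k s \<le> exp_trunc k t"
  unfolding exp_trunc_def by (intro sum_mono divide_right_mono power_mono) auto

text \<open>For \<open>t \<ge> 1\<close> the top term of degree \<open>Suc k\<close> competes with
  at most \<open>W * (k + 1) * t ^ k\<close>. Here \<open>L\<close> bounds the possible loss, and
  beyond \<open>T\<close> the gain in a single coordinate makes up for the loss in \<open>n\<close>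
  coordinates.\<close>

lemma exp_trunc_coercive:
  fixes e W n :: real
  assumes "0 < e" "0 \<le> W" "0 \<le> n"
  obtains T L where "0 \<le> L" "0 \<le> T" "\<And>t. 0 \<le> t \<Longrightarrow> - L \<le> e * exp_trunc (Suc k) t - W * exp_trunc k t"
    "\<And>t. T \<le> t \<Longrightarrow> n * L \<le> e * exp_trunc (Suc k) t - W * exp_trunc k t"
proof -
  define d where "d = e / fact (Suc k)"
  define w where "w = W * (real k + 1)"
  have d: "0 < d" using assms by (simp add: d_def)
  have w: "0 \<le> w" using assms by (simp add: w_def)
  have low: "t ^ k * (d * t - w) \<le> e * exp_trunc (Suc k) t - W * exp_trunc k t" if "1 \<le> t" for t
  proof -
    have "exp_trunc k t \<le> (\<Sum>j\<le>k. t ^ k)"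
      unfolding exp_trunc_def
    proof (intro sum_mono)
      fix j assume "j \<in> {..k}"
      have "t ^ j / fact j \<le> t ^ j / 1" using that by (intro divide_left_mono) auto
      also have "\<dots> \<le> t ^ k" using that \<open>j \<in> {..k}\<close> by (auto intro: power_increasing)
      finally show "t ^ j / fact j \<le> t ^ k" .
    qed
    then have "exp_trunc k t \<le> (real k + 1) * t ^ k" by (simp add: add.commute)
    then have "W * exp_trunc k t \<le> w * t ^ k"
      unfolding w_def mult.assoc using assms by (intro mult_left_mono) auto
    moreover have "e * exp_trunc (Suc k) t = e * exp_trunc k t + d * t * t ^ k"
      by (simp add: exp_trunc_def d_def distrib_left)
    moreover have "0 \<le> e * exp_trunc k t" using assms exp_trunc_ge_1[of t k] that by simp
    ultimately show ?thesis by (simp add: algebra_simps)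
  qed
  \<comment> \<open>From \<open>T1\<close> on the difference is nonnegative; before it, the
    subtracted part is at most \<open>L\<close>.\<close>
  define T1 where "T1 = max 1 (w / d)"
  define L where "L = W * exp_trunc k T1"
  define T where "T = max T1 ((w + n * L) / d)"
  have T1: "1 \<le> T1" by (simp add: T1_def)
  have L: "0 \<le> L" using assms exp_trunc_ge_1[of T1 k] T1 by (simp add: L_def)
  show ?thesis
  proof (rule that[of L T])
    show "0 \<le> L" by (rule L)
    show "0 \<le> T" using T1 by (simp add: T_def)
    fix t :: real
    show "- L \<le> e * exp_trunc (Suc k) t - W * exp_trunc k t" if t: "0 \<le> t"
    proof (cases "T1 \<le> t")
      case True
      then have "w / d \<le> t" "1 \<le> t" by (auto simp: T1_def)
      then have "0 \<le> t ^ k * (d * t - w)" using d by (simp add: field_simps)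
      then show ?thesis using low[OF \<open>1 \<le> t\<close>] L by linarith
    next
      case False
      then have "W * exp_trunc k t \<le> L"
        unfolding L_def using t assms by (intro mult_left_mono exp_trunc_mono) auto
      moreover have "0 \<le> e * exp_trunc (Suc k) t" using assms exp_trunc_ge_1[OF t, of "Suc k"] by simp
      ultimately show ?thesis by linarith
    qed
    show "n * L \<le> e * exp_trunc (Suc k) t - W * exp_trunc k t" if t: "T \<le> t"
    proof -
      have t1: "1 \<le> t" and "(w + n * L) / d \<le> t" using t T1 by (auto simp: T_def)
      then have "w + n * L \<le> d * t" using d by (simp add: field_simps)
      then have "n * L \<le> 1 * (d * t - w)" by simp
      also have "\<dots> \<le> t ^ k * (d * t - w)"
        using t1 \<open>n * L \<le> 1 * (d * t - w)\<close> mult_nonneg_nonneg[OF assms(3) L]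
        by (intro mult_right_mono one_le_power) auto
      finally show ?thesis using low[OF t1] by linarith
    qed
  qed
qed

text \<open>On the compact part where \<open>F \<le> 0\<close> the penalty \<open>G\<close> has a
  positive minimum, so minus the minimum of \<open>F\<close> over the minimum of \<open>G\<close> is
  a sufficient multiplier.\<close>

lemma compact_penalty:
  fixes F G :: "'a::topological_space \<Rightarrow> real"
  assumes K: "compact K" and F: "continuous_on K F" and G: "continuous_on K G"
    and nonneg: "\<And>x. x \<in> K \<Longrightarrow> 0 \<le> G x"
    and pos: "\<And>x. x \<in> K \<Longrightarrow> G x = 0 \<Longrightarrow> 0 < F x"
  shows "\<exists>l\<ge>0. \<forall>x\<in>K. 0 \<le> F x + l * G x"
proof -
  define C where "C = K \<inter> F -` {..0}"
  have C: "compact C"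
  proof -
    obtain U where U: "closed U" "U \<inter> K = F -` {..0} \<inter> K"
      using F unfolding continuous_on_closed_invariant by (metis closed_atMost)
    have "C = U \<inter> K" using U(2) by (auto simp: C_def)
    then show ?thesis using closed_Int_compact[OF U(1) K] by (simp only:)
  qed
  show ?thesis
  proof (cases "C = {}")
    case True
    then have "\<forall>x\<in>K. 0 \<le> F x + 0 * G x" by (force simp: C_def)
    then show ?thesis by blast
  next
    case False
    have sub: "C \<subseteq> K" by (auto simp: C_def)
    obtain x0 where x0: "x0 \<in> C" "\<And>x. x \<in> C \<Longrightarrow> G x0 \<le> G x"
      using continuous_attains_inf[OF C False continuous_on_subset[OF G sub]] by blast
    obtain x1 where x1: "x1 \<in> C" "\<And>x. x \<in> C \<Longrightarrow> F x1 \<le> F x"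
      using continuous_attains_inf[OF C False continuous_on_subset[OF F sub]] by blast
    have G0: "0 < G x0"
      using x0(1) nonneg[of x0] pos[of x0] by (force simp: C_def)
    have F1: "F x1 \<le> 0" using x1(1) by (simp add: C_def)
    show ?thesis
    proof (intro exI conjI ballI)
      show "0 \<le> - F x1 / G x0" using G0 F1 by (simp add: divide_nonpos_pos)
      fix x assume x: "x \<in> K"
      show "0 \<le> F x + - F x1 / G x0 * G x"
      proof (cases "x \<in> C")
        case True
        have "- F x1 = - F x1 / G x0 * G x0" using G0 by simp
        also have "\<dots> \<le> - F x1 / G x0 * G x"
          using \<open>0 \<le> - F x1 / G x0\<close> x0(2)[OF True] by (rule mult_left_mono[rotated])
        finally show ?thesis using x1(2)[OF True] by linarith
      next
        case False
        then have "0 < F x" using x by (auto simp: C_def)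
        moreover have "0 \<le> - F x1 / G x0 * G x" using \<open>0 \<le> - F x1 / G x0\<close> nonneg[OF x] by (rule mult_nonneg_nonneg)
        ultimately show ?thesis by linarith
      qed
    qed
  qed
qed

text \<open>Theta itself bounds the polynomial from below: \<open>f \<ge> - W * theta k\<close>
  pointwise, by the absorption of monomials. One more term of theta then wins, coordinate by
  coordinate.\<close>

lemma perturb_coercive:
  fixes f :: "'n::finite rpoly"
  assumes "0 < e"
  obtains k R where "\<And>x. R < norm x \<Longrightarrow> 0 \<le> eval_poly (f + const_poly e * theta k) x"
proof -
  define k where "k = (\<Sum>\<gamma>\<in>Poly_Mapping.keys f. mdeg \<gamma>)"
  define W where "W = fact CARD('n) * (\<Sum>\<gamma>\<in>Poly_Mapping.keys f. \<bar>Poly_Mapping.lookup f \<gamma>\<bar> * mweight \<gamma>)"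
  have W: "0 \<le> W" unfolding W_def
    by (intro mult_nonneg_nonneg sum_nonneg) (auto simp: mweight_nonneg)
  have "is_sos (const_poly W * theta k + f)"
  proof (rule is_sos_theta_plus_poly[where S = "Poly_Mapping.keys f"])
    fix \<gamma> assume "\<gamma> \<in> Poly_Mapping.keys f"
    then have "mdeg \<gamma> \<le> k" unfolding k_def by (intro member_le_sum) auto
    then show "mdeg \<gamma> \<le> 2 * k" by simp
  qed (auto simp: W_def)
  from is_sos_eval_nonneg[OF this]
  have f: "- W * eval_poly (theta k) x \<le> eval_poly f x" for x
    by (simp add: eval_poly_add eval_poly_mult) (smt (verit))
  obtain T L where L: "0 \<le> L" and T: "0 \<le> T"
    and \<psi>: "\<And>t. 0 \<le> t \<Longrightarrow> - L \<le> e * exp_trunc (Suc k) t - W * exp_trunc k t"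
      "\<And>t. T \<le> t \<Longrightarrow> real CARD('n) * L \<le> e * exp_trunc (Suc k) t - W * exp_trunc k t"
    by (rule exp_trunc_coercive[OF assms W of_nat_0_le_iff[of "CARD('n)"], of k]) (rule that, assumption+)
  define \<psi> where "\<psi> = (\<lambda>t. e * exp_trunc (Suc k) t - W * exp_trunc k t)"
  have \<psi>: "\<And>t. 0 \<le> t \<Longrightarrow> - L \<le> \<psi> t" "\<And>t. T \<le> t \<Longrightarrow> real CARD('n) * L \<le> \<psi> t"
    using \<psi> by (auto simp: \<psi>_def)
  show ?thesis
  proof (rule that)
    fix x :: "real ^ 'n" assume x: "real CARD('n) * sqrt T < norm x"
    \<comment> \<open>The Euclidean norm is at most the sum of the absolute coordinates, so one
      coordinate must be large; it compensates for all the others.\<close>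
    have "\<exists>i. sqrt T < \<bar>x $ i\<bar>"
    proof (rule ccontr)
      assume "\<not> ?thesis"
      then have "(\<Sum>i\<in>UNIV. \<bar>x $ i\<bar>) \<le> real CARD('n) * sqrt T"
        by (intro sum_bounded_above) (auto simp: not_less)
      then show False using x norm_le_l1_cart[of x] by linarith
    qed
    then obtain j where "sqrt T < \<bar>x $ j\<bar>" by blast
    then have "(sqrt T)\<^sup>2 \<le> \<bar>x $ j\<bar>\<^sup>2" using T by (intro power_mono) auto
    then have j: "T \<le> (x $ j)\<^sup>2" using T by simp
    have "0 \<le> real CARD('n) * L + (\<Sum>i\<in>UNIV - {j}. - L)"
    proof -
      have "(\<Sum>i\<in>UNIV - {j}. - L) \<ge> (\<Sum>i\<in>(UNIV :: 'n set). - L)"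
        using L by (simp add: sum_negf card_Diff_singleton_if mult_right_mono)
      then show ?thesis by simp
    qed
    also have "\<dots> \<le> \<psi> ((x $ j)\<^sup>2) + (\<Sum>i\<in>UNIV - {j}. \<psi> ((x $ i)\<^sup>2))"
      by (intro add_mono sum_mono \<psi> j) auto
    also have "\<dots> = (\<Sum>i\<in>UNIV. \<psi> ((x $ i)\<^sup>2))" by (rule sum.remove[symmetric]) auto
    also have "\<dots> = e * eval_poly (theta (Suc k)) x - W * eval_poly (theta k) x"
      by (simp add: \<psi>_def eval_poly_theta sum_subtractf sum_distrib_left)
    also have "\<dots> \<le> eval_poly (f + const_poly e * theta (Suc k)) x"
      using f[of x] by (simp add: eval_poly_add eval_poly_mult)
    finally show "0 \<le> eval_poly (f + const_poly e * theta (Suc k)) x" .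
  qed
qed

lemma l1_norm_const_mult: "l1_norm (const_poly c * p) = \<bar>c\<bar> * l1_norm p"
proof -
  have "l1_norm (const_poly c * p) = (\<Sum>\<alpha>\<in>Poly_Mapping.keys p. \<bar>Poly_Mapping.lookup (const_poly c * p) \<alpha>\<bar>)"
    unfolding l1_norm_def by (rule sum.mono_neutral_left) (auto simp: in_keys_iff)
  then show ?thesis by (simp add: l1_norm_def abs_mult sum_distrib_left)
qed

theorem theorem4p1:
  fixes f :: "'n::finite rpoly" and g :: "nat \<Rightarrow> 'n rpoly" and m :: nat
  assumes f_nonneg: "\<forall>x \<in> real_variety m g. eval_poly f x \<ge> 0"
  shows "(\<forall>\<epsilon>>0. \<exists>(r\<^sub>0::nat) (l :: nat \<Rightarrow> real). (\<forall>j\<in>{1..m}. l j \<ge> 0) \<and>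
            (\<forall>r\<ge>r\<^sub>0. \<exists>q. is_sos q \<and>
               perturb f \<epsilon> r = q - (\<Sum>j=1..m. const_poly (l j) * g j ^ 2)))
       \<and> (\<forall>r. ((\<lambda>\<epsilon>. l1_norm (f - perturb f \<epsilon> r)) \<longlongrightarrow> 0) (at_right 0))"
proof (intro conjI allI impI)
  fix \<epsilon> :: real assume \<epsilon>: "\<epsilon> > 0"
  \<comment> \<open>Half of \<epsilon> is spent on coercivity and strict positivity, the other half
    on the sum of squares representation.\<close>
  obtain k R where kR: "\<And>x. R < norm x \<Longrightarrow> 0 \<le> eval_poly (f + const_poly (\<epsilon> / 2) * theta k) x"
    by (rule perturb_coercive[of "\<epsilon> / 2" f]) (use \<epsilon> in simp, rule that, assumption)
  define F where "F = f + const_poly (\<epsilon> / 2) * theta k"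
  define G where "G = (\<Sum>j=1..m. g j ^ 2)"
  have evG: "eval_poly G x = (\<Sum>j=1..m. (eval_poly (g j) x)\<^sup>2)" for x
    by (simp add: G_def eval_poly_sum eval_poly_power)
  \<comment> \<open>The zeros of \<open>G\<close> form the variety. There \<open>f\<close> is only
    nonnegative; the positive \<open>theta k\<close> supplies the strict inequality.\<close>
  have "\<exists>l\<ge>0. \<forall>x\<in>cball 0 R. 0 \<le> eval_poly F x + l * eval_poly G x"
  proof (rule compact_penalty)
    show "0 \<le> eval_poly G x" for x unfolding evG by (intro sum_nonneg) auto
    fix x assume "eval_poly G x = 0"
    then have "x \<in> real_variety m g"
      unfolding evG real_variety_def by (subst (asm) sum_nonneg_eq_0_iff) auto
    then have "0 \<le> eval_poly f x" using f_nonneg by blast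
    moreover have "0 < eval_poly (theta k) x"
      unfolding eval_poly_theta using exp_trunc_ge_1 by (intro sum_pos) (auto intro: less_le_trans[OF zero_less_one])
    ultimately show "0 < eval_poly F x"
      using \<epsilon> by (simp add: F_def eval_poly_add eval_poly_mult add_nonneg_pos)
  qed (auto intro: continuous_on_eval_poly)
  then obtain l where l: "0 \<le> l" "\<And>x. norm x \<le> R \<Longrightarrow> 0 \<le> eval_poly F x + l * eval_poly G x" by auto
  have "0 \<le> eval_poly (F + const_poly l * G) x" for x
  proof (cases "norm x \<le> R")
    case True
    then show ?thesis using l(2) by (simp add: eval_poly_add eval_poly_mult)
  next
    case False
    then have "0 \<le> eval_poly F x" using kR by (simp add: F_def)
    moreover have "0 \<le> eval_poly G x" unfolding evG by (intro sum_nonneg) auto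
    ultimately show ?thesis using l(1) by (simp add: eval_poly_add eval_poly_mult)
  qed
  then obtain r0 where r0: "\<And>r. r0 \<le> r \<Longrightarrow> is_sos (F + const_poly l * G + const_poly (\<epsilon> / 2) * theta r)"
    using nonneg_plus_theta_is_sos[of "F + const_poly l * G" "\<epsilon> / 2"] \<epsilon> by auto
  have split: "const_poly \<epsilon> = const_poly (\<epsilon> / 2) + (const_poly (\<epsilon> / 2) :: 'n rpoly)"
    by (simp add: const_poly_add[symmetric])
  show "\<exists>(r\<^sub>0::nat) (l :: nat \<Rightarrow> real). (\<forall>j\<in>{1..m}. l j \<ge> 0) \<and>
      (\<forall>r\<ge>r\<^sub>0. \<exists>q. is_sos q \<and> perturb f \<epsilon> r = q - (\<Sum>j=1..m. const_poly (l j) * g j ^ 2))"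
  \<comment> \<open>One multiplier serves for all \<open>j\<close>. The bound
    \<open>k \<le> r\<close> allows \<open>theta k\<close> to be replaced by \<open>theta r\<close>
    at the cost of a sum of squares.\<close>
  proof (rule exI[of _ "max r0 k"], rule exI[of _ "\<lambda>_. l"], intro conjI ballI allI impI)
    show "0 \<le> l" by (rule l(1))
    fix r assume r: "max r0 k \<le> r"
    have "is_sos (const_poly (\<epsilon> / 2) * (theta r - theta k) :: 'n rpoly)"
      using \<epsilon> r by (intro is_sos_const_mult is_sos_theta_diff) auto
    from is_sos_add[OF r0 this, of r] r
    have "is_sos (perturb f \<epsilon> r + const_poly l * G)"
      by (simp add: F_def perturb_def split algebra_simps)
    moreover have "perturb f \<epsilon> r = (perturb f \<epsilon> r + const_poly l * G) - (\<Sum>j=1..m. const_poly l * g j ^ 2)"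
      by (simp add: G_def sum_distrib_left)
    ultimately show "\<exists>q. is_sos q \<and> perturb f \<epsilon> r = q - (\<Sum>j=1..m. const_poly l * g j ^ 2)" by blast
  qed
next
  fix r
  \<comment> \<open>For fixed \<open>r\<close> the perturbation is linear in \<epsilon>, so its norm
    is a constant times the absolute value of \<epsilon>.\<close>
  have "f - perturb f \<epsilon> r = const_poly (- \<epsilon>) * theta r" for \<epsilon>
    by (simp add: perturb_def const_poly_minus)
  then have eq: "l1_norm (f - perturb f \<epsilon> r) = \<bar>\<epsilon>\<bar> * l1_norm (theta r :: 'n rpoly)" for \<epsilon>
    by (simp only: l1_norm_const_mult abs_minus_cancel)
  have "((\<lambda>\<epsilon>. \<bar>\<epsilon>\<bar> * l1_norm (theta r :: 'n rpoly)) \<longlongrightarrow> \<bar>0\<bar> * l1_norm (theta r :: 'n rpoly)) (at_right 0)"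
    by (intro tendsto_intros)
  then show "((\<lambda>\<epsilon>. l1_norm (f - perturb f \<epsilon> r)) \<longlongrightarrow> 0) (at_right 0)" by (simp add: eq)
qed

end
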